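(* Let $X$ be a Hilbert space, let $(T(t))_{t\ge 0}$ be a (strongly continuous) degenerate semigroup on $X$, let $R:\Omega\to L(X)$ be its associated pseudo-resolvent, and assume $0\in\Omega$. Then the following statements are equivalent: (a) $(T(t))_{t\ge0}$ is exponentially stable. (b) There exists a positive operator $Q\in L(X)$ such that $$\langle R(0)x,Qx\rangle+\langle Qx,R(0)x\rangle=-\langle R(0)x,R(0)x\rangle\quad\text{for all }x\in\overline{\operatorname{ran}R(0)}.$$ (c) There exists a positive operator $Q\in L(X)$ such that $$\langle R(0)x,Qx\rangle+\langle Qx,R(0)x\rangle\le-\langle R(0)x,R(0)x\rangle\quad\text{for all }x\in\overline{\operatorname{ran}R(0)}.$$ (d) For every $x\in X$ one has $\int_0^\infty\|T(t)x\|^2\,\mathrm{d}t<\infty$. (e) $R\in H^\infty(L(X))$.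
   Context: $L(X)$ denotes the bounded linear operators on $X$. A degenerate semigroup on $X$ is a strongly continuous mapping $T:(0,\infty)\to L(X)$ with $T(t+s)=T(t)T(s)$ for all $s,t>0$ and $\sup_{0<t\le1}\|T(t)\|<\infty$; since $X$ is a Hilbert space the strong limit $T(0):=\lim_{t\downarrow0}T(t)$ exists, and $T$ is regarded as a function on $[0,\infty)$. The operator $T(0)$ is a bounded projection which need not be the identity. The degenerate semigroup is exponentially stable if there exist $M,\delta>0$ with $\|T(t)\|\le Me^{-\delta t}$ for all $t\ge0$. A pseudo-resolvent is a map $R:\Omega\to L(X)$, $\Omega\subseteq\mathbb{C}$, satisfying, with the sign convention used here, $R(\lambda)-R(\mu)=(\lambda-\mu)R(\lambda)R(\mu)$ for all $\lambda,\mu\in\Omega$. The pseudo-resolvent associated with $T$ is determined by $$R(\lambda)x=-\lim_{\tau\to\infty}\int_0^\tau e^{-\lambda t}T(t)x\,\mathrm{d}t,\qquad x\in X,$$ for $\lambda$ with sufficiently large real part, and $\Omega$ is the (largest) set to which this family extends as a pseudo-resolvent. With this convention, $R(\lambda)=(A_R-\lambda I)^{-1}$ on $X_R:=\operatorname{ran}T(0)$ and $R(\lambda)=0$ on $\ker T(0)$, where $A_R$ is the generator of the $C_0$-semigroup $(T(t)|_{X_R})_{t\ge0}$. A positive operator $Q\in L(X)$ is a self-adjoint operator with $\langle Qx,x\rangle>0$ for all $x\ne0$. The statement $R\in H^\infty(L(X))$ means that the open right half-plane $\{\lambda\in\mathbb{C}:\operatorname{Re}\lambda>0\}$ is contained in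 $\Omega$ and that $R$ is bounded (and holomorphic) there. *)

theory Defs
  imports "HOL-Analysis.Analysis" "HOL-Library.Complex_Order"
begin

section \<open>Complex Hilbert spaces\<close>

text \<open>
  The library has normed spaces and inner products over the reals only. A complex Hilbert space is
  a real one (so that norms, limits, integrals and \<^typ>\<open>'a \<Rightarrow>\<^sub>L 'b\<close> are those of the library)
  with a compatible multiplication by complex scalars and a complex inner product, linear in its
  first argument, whose real part is the real inner product.
\<close>

class scaleC =
  fixes scaleC :: "complex \<Rightarrow> 'a \<Rightarrow> 'a" (infixr \<open>*\<^sub>C\<close> 75)

class complex_normed_vector = real_normed_vector + scaleC +
  assumes scaleC_add_right: "c *\<^sub>C (x + y) = c *\<^sub>C x + c *\<^sub>C y"
    and scaleC_add_left: "(c + d) *\<^sub>C x = c *\<^sub>C x + d *\<^sub>C x"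
    and scaleC_scaleC: "c *\<^sub>C d *\<^sub>C x = (c * d) *\<^sub>C x"
    and scaleC_of_real: "complex_of_real r *\<^sub>C x = r *\<^sub>R x"
    and norm_scaleC: "norm (c *\<^sub>C x) = cmod c * norm x"

class complex_inner = complex_normed_vector + real_inner +
  fixes cinner :: "'a \<Rightarrow> 'a \<Rightarrow> complex"
  assumes cinner_commute: "cinner x y = cnj (cinner y x)"
    and cinner_add_left: "cinner (x + y) z = cinner x z + cinner y z"
    and cinner_scaleC_left: "cinner (c *\<^sub>C x) y = c * cinner x y"
    and Re_cinner: "Re (cinner x y) = x \<bullet> y"

class chilbert_space = complex_inner + complete_space

lemma cinner_self: "cinner x x = complex_of_real ((norm x)\<^sup>2)"
proof -
  have "Im (cinner x x) = 0"
    using arg_cong[OF cinner_commute[of x x], of Im] by simp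
  then show ?thesis
    by (simp add: complex_eq_iff Re_cinner power2_norm_eq_inner)
qed

instantiation complex :: chilbert_space
begin

definition scaleC_complex :: "complex \<Rightarrow> complex \<Rightarrow> complex"
  where "scaleC_complex c x = c * x"

definition cinner_complex :: "complex \<Rightarrow> complex \<Rightarrow> complex"
  where "cinner_complex x y = x * cnj y"

instance
  by standard
    (auto simp: scaleC_complex_def cinner_complex_def algebra_simps norm_mult scaleR_conv_of_real
      inner_complex_def)

end

lemma bounded_linear_scaleC: "bounded_linear (\<lambda>x :: 'a :: complex_normed_vector. c *\<^sub>C x)"
proof (rule bounded_linear_intro[where K = "cmod c"])
  fix r and x y :: 'a
  show "c *\<^sub>C (x + y) = c *\<^sub>C x + c *\<^sub>C y"
    by (rule scaleC_add_right)
  show "c *\<^sub>C (r *\<^sub>R x) = r *\<^sub>R (c *\<^sub>C x)"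
    by (simp add: scaleC_of_real[symmetric] scaleC_scaleC mult.commute)
  show "norm (c *\<^sub>C x) \<le> norm x * cmod c"
    by (simp add: norm_scaleC mult.commute)
qed

instantiation blinfun :: (real_normed_vector, complex_normed_vector) complex_normed_vector
begin

lift_definition scaleC_blinfun :: "complex \<Rightarrow> ('a \<Rightarrow>\<^sub>L 'b) \<Rightarrow> ('a \<Rightarrow>\<^sub>L 'b)"
  is "\<lambda>c f x. c *\<^sub>C f x"
  by (rule bounded_linear_compose[OF bounded_linear_scaleC])

instance
proof
  fix c d :: complex and r :: real and f g :: "'a \<Rightarrow>\<^sub>L 'b"
  show "c *\<^sub>C (f + g) = c *\<^sub>C f + c *\<^sub>C g"
    by transfer (simp add: scaleC_add_right)
  show "(c + d) *\<^sub>C f = c *\<^sub>C f + d *\<^sub>C f"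
    by transfer (simp add: scaleC_add_left)
  show "c *\<^sub>C d *\<^sub>C f = (c * d) *\<^sub>C f"
    by transfer (simp add: scaleC_scaleC)
  show "complex_of_real r *\<^sub>C f = r *\<^sub>R f"
    by transfer (simp add: scaleC_of_real)
  show "norm (c *\<^sub>C f) = cmod c * norm f"
  proof (rule antisym)
    have le: "norm (e *\<^sub>C h) \<le> cmod e * norm h" for e and h :: "'a \<Rightarrow>\<^sub>L 'b"
    proof (rule norm_blinfun_bound)
      fix x
      have "norm (blinfun_apply (e *\<^sub>C h) x) = cmod e * norm (blinfun_apply h x)"
        by (simp add: scaleC_blinfun.rep_eq norm_scaleC)
      also have "\<dots> \<le> cmod e * (norm h * norm x)"
        by (intro mult_left_mono norm_blinfun) auto
      finally show "norm (blinfun_apply (e *\<^sub>C h) x) \<le> cmod e * norm h * norm x"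
        by (simp add: mult.assoc)
    qed simp
    show "norm (c *\<^sub>C f) \<le> cmod c * norm f"
      by (rule le)
    show "cmod c * norm f \<le> norm (c *\<^sub>C f)"
    proof (cases "c = 0")
      case False
      have "inverse c *\<^sub>C c *\<^sub>C f = f"
        using False scaleC_of_real[of 1]
        by (intro blinfun_eqI) (simp add: scaleC_blinfun.rep_eq scaleC_scaleC)
      then have "norm f \<le> cmod (inverse c) * norm (c *\<^sub>C f)"
        using le[of "inverse c" "c *\<^sub>C f"] by simp
      then show ?thesis
        using False by (simp add: norm_divide field_simps)
    qed simp
  qed
qed

end


section \<open>Operators and operator-valued functions\<close>

text \<open>
  Elements of \<^typ>\<open>'a \<Rightarrow>\<^sub>L 'a\<close> are linear over the reals; those that are linear over the complex
  numbers form $L(X)$.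
\<close>

definition LX :: "('a :: complex_normed_vector \<Rightarrow>\<^sub>L 'a) set"
  where "LX = {A. \<forall>c x. blinfun_apply A (c *\<^sub>C x) = c *\<^sub>C A x}"

definition positive_operator :: "('a :: complex_inner \<Rightarrow>\<^sub>L 'a) \<Rightarrow> bool"
  where "positive_operator Q \<longleftrightarrow>
    Q \<in> LX \<and> (\<forall>x y. cinner (Q x) y = cinner x (Q y)) \<and> (\<forall>x. x \<noteq> 0 \<longrightarrow> 0 < cinner (Q x) x)"

text \<open>The library's \<^const>\<open>holomorphic_on\<close> covers only complex-valued functions.\<close>

definition vholomorphic_on :: "(complex \<Rightarrow> 'b :: complex_normed_vector) \<Rightarrow> complex set \<Rightarrow> bool"
    (infix \<open>vholomorphic'_on\<close> 50)
  where "f vholomorphic_on S \<longleftrightarrow>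
    (\<forall>z\<in>S. \<exists>D. (f has_derivative (\<lambda>h. h *\<^sub>C D)) (at z within S))"


section \<open>Degenerate semigroups and their pseudo-resolvents\<close>

text \<open>
  The values of \<open>T\<close> at negative arguments are irrelevant. The value at \<open>0\<close> is defined to be the
  strong limit, whose existence in a Hilbert space follows from the other conditions.
\<close>

definition degenerate_semigroup :: "(real \<Rightarrow> 'a :: chilbert_space \<Rightarrow>\<^sub>L 'a) \<Rightarrow> bool"
  where "degenerate_semigroup T \<longleftrightarrow>
    (\<forall>t>0. T t \<in> LX) \<and>
    (\<forall>x. continuous_on {0<..} (\<lambda>t. T t x)) \<and>
    (\<forall>t>0. \<forall>s>0. T (t + s) = T t o\<^sub>L T s) \<and>
    bounded (T ` {0<..1}) \<and>
    (\<forall>x. T 0 x = Lim (at_right 0) (\<lambda>t. T t x))"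

definition exponentially_stable :: "(real \<Rightarrow> 'a :: chilbert_space \<Rightarrow>\<^sub>L 'a) \<Rightarrow> bool"
  where "exponentially_stable T \<longleftrightarrow>
    (\<exists>M>0. \<exists>\<delta>>0. \<forall>t\<ge>0. norm (T t) \<le> M * exp (- \<delta> * t))"

definition pseudo_resolvent ::
    "complex set \<Rightarrow> (complex \<Rightarrow> 'a :: complex_normed_vector \<Rightarrow>\<^sub>L 'a) \<Rightarrow> bool"
  where "pseudo_resolvent \<Omega> R \<longleftrightarrow>
    (\<forall>z\<in>\<Omega>. R z \<in> LX) \<and>
    (\<forall>z\<in>\<Omega>. \<forall>w\<in>\<Omega>. R z - R w = (z - w) *\<^sub>C (R z o\<^sub>L R w))"

definition extends_laplace_transform ::
    "(real \<Rightarrow> 'a :: chilbert_space \<Rightarrow>\<^sub>L 'a) \<Rightarrow> complex set \<Rightarrow> (complex \<Rightarrow> 'a \<Rightarrow>\<^sub>L 'a) \<Rightarrow> bool"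
  where "extends_laplace_transform T \<Omega> R \<longleftrightarrow>
    (\<exists>\<omega>. \<forall>z. \<omega> < Re z \<longrightarrow> z \<in> \<Omega> \<and>
      (\<forall>x. ((\<lambda>\<tau>. - integral {0..\<tau>} (\<lambda>t. exp (- z * of_real t) *\<^sub>C T t x)) \<longlongrightarrow> R z x) at_top))"

text \<open>The last conjunct says that \<open>\<Omega>\<close> is the largest possible domain.\<close>

definition associated_pseudo_resolvent ::
    "(real \<Rightarrow> 'a :: chilbert_space \<Rightarrow>\<^sub>L 'a) \<Rightarrow> complex set \<Rightarrow> (complex \<Rightarrow> 'a \<Rightarrow>\<^sub>L 'a) \<Rightarrow> bool"
  where "associated_pseudo_resolvent T \<Omega> R \<longleftrightarrow>
    pseudo_resolvent \<Omega> R \<and> extends_laplace_transform T \<Omega> R \<and>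
    (\<forall>\<Omega>' R'. pseudo_resolvent \<Omega>' R' \<and> extends_laplace_transform T \<Omega>' R' \<longrightarrow> \<Omega>' \<subseteq> \<Omega>)"

definition in_H_infinity ::
    "complex set \<Rightarrow> (complex \<Rightarrow> 'a :: complex_normed_vector \<Rightarrow>\<^sub>L 'a) \<Rightarrow> bool"
  where "in_H_infinity \<Omega> R \<longleftrightarrow>
    {z. 0 < Re z} \<subseteq> \<Omega> \<and> bounded (R ` {z. 0 < Re z}) \<and> R vholomorphic_on {z. 0 < Re z}"

end

theory Submission
  imports Defs "HOL-Probability.Probability"
begin

text \<open>
  The implication from (e) to (a) is the theorem of Gearhart and Pruess. By Plancherel's identity,
  the square integral of $e^{-\eta t} T(t) x$ is the integral of $\|R(\eta + i s) x\|^2$ over $s$,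
  up to a factor. The resolvent identity compares it with the same integral on a line
  $\operatorname{Re} z = \omega_1$ to the right of the growth bound, so a bounded resolvent gives an
  estimate uniform in $\eta$. By the quantitative form of Datko's theorem, the growth bound can then
  be lowered by a fixed amount, repeatedly, until it is negative. Plancherel's identity itself is
  obtained by averaging the square of the transform against Gaussians whose width tends to infinity.

  For the Lyapunov statements, $t \mapsto T(t) R(0) x$ has derivative $T(t) x$, and the vectors
  $T(t) x$ lie in the closure of the range of $R(0)$. Hence (c) bounds the square integral of
  $T(t) v$ by $\langle Q v, v \rangle$. Conversely, $Q$ is built from
  $\int_0^\infty T(t)^* T(t) \, dt$, made strictly positive by adding $(I - T(0))^* (I - T(0))$,
  which vanishes on the range of $R(0)$.
\<close>

subsection \<open>Hilbert space and Banach space preliminaries\<close>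

text \<open>\<open>X\<close> is not assumed separable, so vector-valued integrals stay gauge
  integrals over compact intervals, and Lebesgue integration is applied only to scalar functions
  such as inner products. Where weak compactness would be the usual tool, a nonempty intersection of
  nested bounded closed convex sets is used.

  Gaussian averages enter because the kernel <g t, g u> is integrable over the quadrant, while
  square integrability of the transform is not known beforehand. Fubini against a probability
  measure is then available, and two transforms can be compared before the width goes to infinity.

  From (e) to (a), the Laplace integral is known to converge only to the right of the current growth
  bound, so the imaginary axis cannot be reached at once. The repeated lowering of the bound
  succeeds because the contraction time is fixed by the supremum of the resolvent, the bound of
  \<open>T\<close> on [0,1] and the very first growth estimate. The multiplicative constants of the
  later growth estimates may deteriorate freely, as they never enter it.\<close>

instance chilbert_space \<subseteq> banach ..

text \<open>Serves as a substitute for weak compactness. Points of almost minimal norm in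
  \<open>C n\<close> form a Cauchy sequence, because the minimal norms \<open>d n\<close> increase
  to a finite limit and midpoints stay in the convex sets.\<close>

lemma nested_closed_convex_nonempty:
  fixes C :: "nat \<Rightarrow> 'a::{real_inner, complete_space} set"
  assumes cl: "\<And>n. closed (C n)" and cv: "\<And>n. convex (C n)" and ne: "\<And>n. C n \<noteq> {}"
    and dec: "decseq C" and bd: "bounded (C 0)"
  shows "(\<Inter>n. C n) \<noteq> {}"
proof -
  obtain K where K: "\<And>x. x \<in> C 0 \<Longrightarrow> norm x \<le> K"
    using bd by (auto simp: bounded_iff)
  have sub0: "C n \<subseteq> C 0" for n
    using dec by (auto simp: decseq_def)
  define d where "d n = Inf (norm ` C n)" for n
  have bb: "bdd_below (norm ` C n)" for n
    by (rule bdd_belowI[of _ 0]) auto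
  have d_le: "d n \<le> norm x" if "x \<in> C n" for n x
    unfolding d_def using that bb by (intro cInf_lower) auto
  have d0: "0 \<le> d n" for n
    unfolding d_def using ne by (intro cInf_greatest) auto
  have "incseq d"
    unfolding d_def incseq_def using dec ne bb
    by (intro allI impI cInf_superset_mono image_mono) (auto simp: decseq_def)
  moreover have "d n \<le> K" for n
    using ne[of n] d_le[of _ n] K sub0[of n] by (meson ex_in_conv order_trans subsetD)
  ultimately obtain D where D: "d \<longlonglongrightarrow> D" "\<And>n. d n \<le> D"
    using incseq_convergent[of d K] by auto
  have "\<exists>y\<in>C n. norm y < d n + 1 / real (Suc n)" for n
  proof -
    have "\<exists>a\<in>norm ` C n. a < d n + 1 / real (Suc n)"
      unfolding d_def by (rule cInf_lessD) (use ne in auto)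
    then show ?thesis by auto
  qed
  then obtain y where y: "\<And>n. y n \<in> C n" "\<And>n. norm (y n) < d n + 1 / real (Suc n)"
    by metis
  \<comment> \<open>Parallelogram law: for m, n \<ge> N the midpoint of \<open>y m\<close> and
    \<open>y n\<close> lies in \<open>C N\<close>, so its norm is at least \<open>d N\<close>, while
    both norms are at most \<open>D + 1 / (N + 1)\<close>. This is the resulting bound on the
    distance.\<close>
  define e where "e N = sqrt (4 * ((D + 1 / real (Suc N))\<^sup>2 - (d N)\<^sup>2))" for N
  have "(\<lambda>N. sqrt (4 * ((D + 1 / real (Suc N))\<^sup>2 - (d N)\<^sup>2))) \<longlonglongrightarrow> sqrt (4 * ((D + 0)\<^sup>2 - D\<^sup>2))"
    by (intro tendsto_intros D) (use LIMSEQ_inverse_real_of_nat in \<open>simp add: inverse_eq_divide\<close>)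
  then have e: "e \<longlonglongrightarrow> 0"
    by (simp add: e_def[abs_def])
  have close: "norm (y m - y n) \<le> e N" if mn: "N \<le> m" "N \<le> n" for m n N
  proof -
    have inC: "y m \<in> C N" "y n \<in> C N"
      using y(1) dec mn by (auto simp: decseq_def)
    have le: "norm (y k) \<le> D + 1 / real (Suc N)" if "N \<le> k" for k
    proof -
      have "1 / real (Suc k) \<le> 1 / real (Suc N)"
        using that by (simp add: frac_le)
      then show ?thesis
        using y(2)[of k] D(2)[of k] by linarith
    qed
    have "(1/2) *\<^sub>R y m + (1/2) *\<^sub>R y n \<in> C N"
      using cv[of N] inC by (intro convexD) auto
    from d_le[OF this] have "d N \<le> norm (y m + y n) / 2"
      by (simp flip: scaleR_add_right)
    then have "(2 * d N)\<^sup>2 \<le> (norm (y m + y n))\<^sup>2"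
      using d0 by (intro power_mono) auto
    moreover have "(norm (y m))\<^sup>2 \<le> (D + 1 / real (Suc N))\<^sup>2" "(norm (y n))\<^sup>2 \<le> (D + 1 / real (Suc N))\<^sup>2"
      using le mn by (auto intro!: power_mono)
    moreover have "(norm (y m - y n))\<^sup>2 = 2 * (norm (y m))\<^sup>2 + 2 * (norm (y n))\<^sup>2 - (norm (y m + y n))\<^sup>2"
      by (simp add: power2_norm_eq_inner algebra_simps inner_commute)
    ultimately have "(norm (y m - y n))\<^sup>2 \<le> 4 * ((D + 1 / real (Suc N))\<^sup>2 - (d N)\<^sup>2)"
      by (simp add: power_mult_distrib)
    then show ?thesis
      unfolding e_def by (rule real_le_rsqrt)
  qed
  have "Cauchy y"
  proof (rule CauchyI)
    fix r :: real assume "0 < r"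
    with e have "\<forall>\<^sub>F N in sequentially. e N < r"
      by (rule order_tendstoD)
    then obtain N where "e N < r"
      by (auto simp: eventually_sequentially)
    then show "\<exists>M. \<forall>m\<ge>M. \<forall>n\<ge>M. norm (y m - y n) < r"
      using close by (meson le_less_trans)
  qed
  then obtain l where l: "y \<longlonglongrightarrow> l"
    using Cauchy_convergent convergent_def by blast
  have "l \<in> C n" for n
  proof (rule Lim_in_closed_set[OF cl _ _ l])
    show "\<forall>\<^sub>F k in sequentially. y k \<in> C n"
      using y(1) dec unfolding eventually_sequentially decseq_def by blast
  qed auto
  then show ?thesis by auto
qed

text \<open>The point of least norm on the hyperplane f = 1 is orthogonal to the kernel of f; it
  exists because the slices \<open>C n\<close> of the hyperplane by shrinking balls are nested. Real
  functionals are enough, since complex linearity is recovered afterwards from the real inner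
  product.\<close>

lemma Riesz_representation:
  fixes f :: "'a::{real_inner, complete_space} \<Rightarrow> real"
  assumes f: "bounded_linear f"
  shows "\<exists>y. \<forall>x. f x = y \<bullet> x"
proof (cases "\<forall>x. f x = 0")
  case True
  then show ?thesis by (intro exI[of _ 0]) simp
next
  case False
  then obtain x0 where x0: "f x0 \<noteq> 0" by auto
  interpret f: bounded_linear f by fact
  let ?S = "{y. f y = 1}"
  have ne: "x0 /\<^sub>R f x0 \<in> ?S"
    using x0 by (simp add: f.scaleR)
  define d where "d = Inf (norm ` ?S)"
  have d_le: "d \<le> norm y" if "f y = 1" for y
    unfolding d_def using that by (intro cInf_lower bdd_belowI[of _ 0]) auto
  define C where "C n = {y. f y = 1} \<inter> {y. norm y \<le> d + 1 / real (Suc n)}" for n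
  have "(\<Inter>n. C n) \<noteq> {}"
  proof (rule nested_closed_convex_nonempty)
    show "closed (C n)" for n
      unfolding C_def
      by (intro closed_Int closed_Collect_eq closed_Collect_le continuous_intros f.continuous_on)
    have eq: "C n = {y. f y = 1} \<inter> cball 0 (d + 1 / real (Suc n))" for n
      by (auto simp: C_def)
    show "convex (C n)" for n
      unfolding eq by (intro convex_Int convex_cball) (auto simp: convex_def f.add f.scaleR)
    show "C n \<noteq> {}" for n
    proof -
      have "\<exists>a\<in>norm ` ?S. a < d + 1 / real (Suc n)"
        unfolding d_def by (rule cInf_lessD) (use ne in auto)
      then show ?thesis by (auto simp: C_def less_imp_le)
    qed
    show "decseq C"
      by (auto simp: C_def decseq_def elim!: order_trans intro!: divide_left_mono)
    show "bounded (C 0)"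
      by (auto simp: C_def bounded_iff)
  qed
  then obtain y where y: "\<And>n. y \<in> C n" by auto
  then have fy: "f y = 1" by (auto simp: C_def)
  have "norm y \<le> d"
  proof (rule field_le_epsilon)
    fix e :: real assume "0 < e"
    then obtain n where "1 / real (Suc n) < e"
      using nat_approx_posE by blast
    moreover have "norm y \<le> d + 1 / real (Suc n)"
      using y[of n] by (simp add: C_def)
    ultimately show "norm y \<le> d + e" by linarith
  qed
  have ortho: "y \<bullet> h = 0" if h: "f h = 0" for h
  proof (rule ccontr)
    assume nz: "y \<bullet> h \<noteq> 0"
    \<comment> \<open>The minimiser of the quadratic polynomial t \<mapsto> norm (y + t h) squared;
      a nonzero \<open>y \<bullet> h\<close> would make its minimum smaller than the value at
      0.\<close>
    define t where "t = - (y \<bullet> h) / (h \<bullet> h)"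
    have "h \<noteq> 0" using nz by auto
    then have hh: "h \<bullet> h > 0" by simp
    have "norm y \<le> norm (y + t *\<^sub>R h)"
      using \<open>norm y \<le> d\<close> d_le[of "y + t *\<^sub>R h"] h fy by (simp add: f.add f.scaleR)
    then have "(norm y)\<^sup>2 \<le> (norm (y + t *\<^sub>R h))\<^sup>2"
      by (intro power_mono) auto
    then have "0 \<le> 2 * t * (y \<bullet> h) + t * t * (h \<bullet> h)"
      by (simp add: power2_norm_eq_inner algebra_simps inner_commute)
    also have "\<dots> = - ((y \<bullet> h) * (y \<bullet> h) / (h \<bullet> h))"
      using hh by (simp add: t_def field_simps)
    finally show False
      using hh nz by (smt (verit) divide_pos_pos not_real_square_gt_zero)
  qed
  have ny: "y \<bullet> y \<noteq> 0"
    using fy f.zero by auto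
  have "f x = (y /\<^sub>R (y \<bullet> y)) \<bullet> x" for x
  proof -
    have "y \<bullet> (x - f x *\<^sub>R y) = 0"
      by (rule ortho) (simp add: f.diff f.scaleR fy)
    then show ?thesis
      using ny by (simp add: inner_diff_right field_simps)
  qed
  then show ?thesis by blast
qed

text \<open>By Baire, some set \<open>E n\<close> of points where the family is bounded by n
  contains a ball of radius r. Subtracting the values at its centre bounds every \<open>F i\<close>
  by 2n on the sphere of radius r about 0.\<close>

lemma Banach_Steinhaus:
  fixes F :: "'i \<Rightarrow> 'a::banach \<Rightarrow>\<^sub>L 'b::real_normed_vector"
  assumes pw: "\<And>x. \<exists>C. \<forall>i\<in>I. norm (F i x) \<le> C"
  shows "\<exists>C. \<forall>i\<in>I. norm (F i) \<le> C"
proof -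
  define E where "E n = (\<Inter>i\<in>I. {x. norm (F i x) \<le> real n})" for n :: nat
  have "\<exists>n. interior (E n) \<noteq> {}"
  proof (rule ccontr)
    assume empty: "\<not> (\<exists>n. interior (E n) \<noteq> {})"
    have "euclidean interior_of \<Union>(range E) = {}"
    proof (rule Baire_category_alt)
      show "completely_metrizable_space (euclidean :: 'a topology)
          \<or> locally_compact_space (euclidean :: 'a topology) \<and> regular_space (euclidean :: 'a topology)"
        using completely_metrizable_space_euclidean by blast
      fix S assume "S \<in> range E"
      moreover have "closed (E n)" for n
        unfolding E_def by (intro closed_INT ballI closed_Collect_le continuous_intros)
      ultimately show "closedin euclidean S \<and> euclidean interior_of S = {}"
        using empty by auto
    qed auto
    moreover have "\<Union>(range E) = UNIV"
    proof -
      have "\<exists>n. x \<in> E n" for x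
      proof -
        obtain C where "\<forall>i\<in>I. norm (F i x) \<le> C" using pw by blast
        then show ?thesis
          using real_arch_simple[of C] by (fastforce simp: E_def intro: order_trans)
      qed
      then show ?thesis by auto
    qed
    ultimately show False by simp
  qed
  then obtain n a where "a \<in> interior (E n)" by auto
  then obtain r where r: "r > 0" "cball a r \<subseteq> E n"
    by (meson mem_interior_cball)
  have "norm (F i) \<le> 2 * real n / r" if i: "i \<in> I" for i
  proof (rule norm_blinfun_bound)
    show "0 \<le> 2 * real n / r" using r by simp
    fix x
    show "norm (F i x) \<le> 2 * real n / r * norm x"
    proof (cases "x = 0")
      case False
      define u where "u = (r / norm x) *\<^sub>R x"
      have "norm u = r" using False r by (simp add: u_def)
      then have "a + u \<in> E n" "a \<in> E n"
        using r by (auto simp: dist_norm)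
      then have "norm (F i (a + u)) \<le> n" "norm (F i a) \<le> n"
        using i by (auto simp: E_def)
      moreover have "F i u = F i (a + u) - F i a"
        by (simp add: blinfun.add_right)
      ultimately have "norm (F i u) \<le> 2 * real n"
        by (smt (verit) norm_triangle_ineq4)
      then show ?thesis
        using False r by (simp add: u_def blinfun.scaleR_right field_simps)
    qed simp
  qed
  then show ?thesis by blast
qed

subsection \<open>Degenerate semigroups and growth\<close>

interpretation scaleC: bounded_bilinear "\<lambda>c (x :: 'a::complex_normed_vector). c *\<^sub>C x"
proof
  fix a a' :: complex and b b' :: 'a and r :: real
  show "(a + a') *\<^sub>C b = a *\<^sub>C b + a' *\<^sub>C b" "a *\<^sub>C (b + b') = a *\<^sub>C b + a *\<^sub>C b'"
    by (rule scaleC_add_left scaleC_add_right)+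
  show "(r *\<^sub>R a) *\<^sub>C b = r *\<^sub>R (a *\<^sub>C b)"
    unfolding scaleR_conv_of_real scaleC_scaleC[symmetric] scaleC_of_real ..
  show "a *\<^sub>C (r *\<^sub>R b) = r *\<^sub>R (a *\<^sub>C b)"
    by (simp add: scaleC_of_real[symmetric] scaleC_scaleC mult.commute)
  show "\<exists>K. \<forall>(a :: complex) (b :: 'a). norm (a *\<^sub>C b) \<le> norm a * norm b * K"
    by (rule exI[of _ 1]) (simp add: norm_scaleC)
qed

lemma scaleC_one [simp]: "1 *\<^sub>C x = (x :: 'a::complex_normed_vector)"
  using scaleC_of_real[of 1 x] by simp

lemma cinner_scaleC_right: "cinner x (c *\<^sub>C y) = cnj c * cinner x y"
  by (metis cinner_commute cinner_scaleC_left complex_cnj_mult)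

lemma inner_scaleC_left: "(c *\<^sub>C x) \<bullet> y = (x :: 'a::complex_inner) \<bullet> (cnj c *\<^sub>C y)"
  by (simp flip: Re_cinner add: cinner_scaleC_left cinner_scaleC_right)

lemma scaleC_blinfun_apply [simp]: "blinfun_apply (c *\<^sub>C A) x = c *\<^sub>C (A x :: 'a::complex_normed_vector)"
  by (simp add: scaleC_blinfun.rep_eq)

lemma LX_apply: "A \<in> LX \<Longrightarrow> blinfun_apply A (c *\<^sub>C x) = c *\<^sub>C A x"
  by (simp add: LX_def)

text \<open>The addition law includes the argument 0, so \<open>T 0\<close> is a projection that
  fixes every range \<open>T t\<close> and may differ from the identity. The axioms are stable under
  multiplication by exp (-\<eta> t).\<close>

locale operator_semigroup =
  fixes T :: "real \<Rightarrow> 'a::chilbert_space \<Rightarrow>\<^sub>L 'a"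
  assumes in_LX: "0 \<le> t \<Longrightarrow> T t \<in> LX"
    and add: "0 \<le> s \<Longrightarrow> 0 \<le> t \<Longrightarrow> T (s + t) = T s o\<^sub>L T t"
    and cont: "continuous_on {0..} (\<lambda>t. T t x)"

lemma degenerate_semigroup_tendsto_shift:
  fixes T :: "real \<Rightarrow> 'a::chilbert_space \<Rightarrow>\<^sub>L 'a"
  assumes "degenerate_semigroup T" "s > 0"
  shows "((\<lambda>t. T (s + t) x) \<longlongrightarrow> T s x) (at_right 0)"
proof -
  have "continuous_on {0<..} (\<lambda>t. T t x)"
    using assms by (simp add: degenerate_semigroup_def)
  then have "((\<lambda>t. T t x) \<longlongrightarrow> T s x) (at s)"
    using assms by (simp add: continuous_on_eq_continuous_at open_greaterThan isCont_def)
  then have "((\<lambda>t. T t x) \<longlongrightarrow> T s x) (at_right s)"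
    by (rule filterlim_mono) (auto simp: at_le)
  then show ?thesis
    by (simp add: at_right_to_0[of s] filterlim_filtermap add.commute)
qed

text \<open>
  The intersection of the closed convex hulls of the orbit pieces \<open>T ` {0<..1/n}\<close> plays the role of
  a weak limit point \<open>y\<close> of \<open>T t x\<close>: it satisfies \<open>T s y = T s x\<close>, and \<open>T t y\<close> tends to \<open>y\<close> because
  \<open>y\<close> lies in the closed span of the ranges.
\<close>

lemma degenerate_semigroup_strong_limit:
  fixes T :: "real \<Rightarrow> 'a::chilbert_space \<Rightarrow>\<^sub>L 'a"
  assumes "degenerate_semigroup T"
  shows "((\<lambda>t. T t x) \<longlongrightarrow> T 0 x) (at_right 0)"
proof -
  have cont: "\<And>x. continuous_on {0<..} (\<lambda>t. T t x)"
    and add: "\<And>s t. t > 0 \<Longrightarrow> s > 0 \<Longrightarrow> T (t + s) = T t o\<^sub>L T s"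
    and bd: "bounded (T ` {0<..1})" and lim: "\<And>x. T 0 x = Lim (at_right 0) (\<lambda>t. T t x)"
    using assms by (auto simp: degenerate_semigroup_def)
  obtain K where K: "\<And>t. 0 < t \<Longrightarrow> t \<le> 1 \<Longrightarrow> norm (T t) \<le> K"
    using bd by (fastforce simp: bounded_iff)
  have "0 \<le> K" using K[of 1] norm_ge_zero[of "T 1"] by linarith
  have Kx: "norm (T t v) \<le> K * norm v" if "0 < t" "t \<le> 1" for t v
    using norm_blinfun[of "T t" v] K[OF that] by (meson mult_right_mono norm_ge_zero order_trans)
  note shift = degenerate_semigroup_tendsto_shift[OF assms]
  define C where "C n = closure (convex hull ((\<lambda>t. T t x) ` {0<..1 / real (Suc n)}))" for n
  have "(\<Inter>n. C n) \<noteq> {}"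
  proof (rule nested_closed_convex_nonempty)
    show "closed (C n)" "convex (C n)" for n
      by (auto simp: C_def intro!: convex_closure convex_convex_hull)
    show "C n \<noteq> {}" for n
      by (auto simp: C_def)
    show "decseq C"
      unfolding C_def decseq_def
      by (intro allI impI closure_mono hull_mono image_mono) (auto elim!: order_trans intro!: divide_left_mono)
    show "bounded (C 0)"
      unfolding C_def
      by (intro bounded_closure bounded_convex_hull) (auto simp: bounded_iff intro!: exI[of _ "K * norm x"] Kx)
  qed
  then obtain y where y: "\<And>n. y \<in> C n" by auto
  have Ty: "T s y = T s x" if s: "s > 0" for s
  proof -
    have "dist (T s x) (T s y) \<le> e" if "e > 0" for e
    proof -
      have "\<forall>\<^sub>F t in at_right 0. dist (T (s + t) x) (T s x) < e"
        using shift[OF s] \<open>e > 0\<close> by (simp add: tendsto_iff)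
      then obtain b where b: "b > 0" "\<And>t. 0 < t \<Longrightarrow> t < b \<Longrightarrow> dist (T (s + t) x) (T s x) < e"
        by (auto simp: eventually_at_right[of 0 1])
      obtain n where n: "1 / real (Suc n) < b" using b nat_approx_posE by blast
      \<comment> \<open>The preimage of a closed ball under \<open>T s\<close> is closed and convex,
        so it suffices to test the orbit points \<open>T t x\<close>, which \<open>T s\<close> sends
        to \<open>T (s + t) x\<close>.\<close>
      have "C n \<subseteq> T s -` cball (T s x) e"
        unfolding C_def
      proof (rule closure_minimal, rule hull_minimal)
        show "(\<lambda>t. T t x) ` {0<..1 / real (Suc n)} \<subseteq> T s -` cball (T s x) e"
        proof (intro image_subsetI)
          fix t assume t: "t \<in> {0<..1 / real (Suc n)}"
          then have "dist (T (s + t) x) (T s x) < e"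
            using n by (intro b) auto
          then show "T t x \<in> T s -` cball (T s x) e"
            using t s add by (simp add: dist_commute)
        qed
        show "convex (T s -` cball (T s x) e)"
          by (intro convex_linear_vimage convex_cball bounded_linear.linear blinfun.bounded_linear_right)
        show "closed (T s -` cball (T s x) e)"
          by (intro continuous_closed_vimage closed_cball continuous_intros)
      qed
      with y[of n] show ?thesis by auto
    qed
    then show ?thesis
      by (metis dist_nz linorder_not_less field_lbound_gt_zero)
  qed
  \<comment> \<open>The set of v with T t v \<longlonglongrightarrow> v is convex, and it is closed
    thanks to the uniform bound \<open>K\<close> on (0,1]. It contains \<open>T s x\<close> for s >
    0 by continuity at s, hence it contains the whole hull.\<close>
  have "C 0 \<subseteq> {v. ((\<lambda>t. T t v) \<longlongrightarrow> v) (at_right 0)}" (is "_ \<subseteq> ?W")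
    unfolding C_def
  proof (rule closure_minimal, rule hull_minimal)
    have "((\<lambda>t. T t (T s x)) \<longlongrightarrow> T s x) (at_right 0)" if s: "s > 0" for s
    proof (rule Lim_transform_eventually[OF shift[OF s]])
      show "\<forall>\<^sub>F t in at_right 0. T (s + t) x = T t (T s x)"
        using s add by (auto simp: eventually_at_right[of 0 1] add.commute[of s] intro!: exI[of _ 1])
    qed
    then show "(\<lambda>t. T t x) ` {0<..1 / real (Suc 0)} \<subseteq> ?W" by auto
    show "convex ?W"
      by (auto simp: convex_def blinfun.add_right blinfun.scaleR_right intro!: tendsto_intros)
    show "closed ?W"
      unfolding closed_sequential_limits
    proof (safe)
      fix u v assume u: "\<forall>n. u n \<in> ?W" "u \<longlonglongrightarrow> v"
      show "((\<lambda>t. T t v) \<longlongrightarrow> v) (at_right 0)"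
      proof (rule tendstoI)
        fix e :: real assume e: "0 < e"
        then have "0 < e / (2 * (K + 1))" using \<open>0 \<le> K\<close> by simp
        then have "\<forall>\<^sub>F n in sequentially. dist (u n) v < e / (2 * (K + 1))"
          using u(2) by (simp add: tendsto_iff)
        then obtain n where "dist (u n) v < e / (2 * (K + 1))"
          by (auto simp: eventually_sequentially)
        then have n: "(K + 1) * norm (v - u n) < e / 2"
          using \<open>0 \<le> K\<close> by (simp add: dist_norm norm_minus_commute field_simps)
        have "\<forall>\<^sub>F t in at_right 0. dist (T t (u n)) (u n) < e / 2"
          by (rule tendstoD) (use u(1) e in auto)
        moreover have "\<forall>\<^sub>F t::real in at_right 0. 0 < t \<and> t \<le> 1"
          by (auto simp: eventually_at_right[of 0 1] intro!: exI[of _ 1])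
        ultimately show "\<forall>\<^sub>F t in at_right 0. dist (T t v) v < e"
        proof eventually_elim
          case (elim t)
          have "T t v - v = T t (v - u n) + (T t (u n) - u n) - (v - u n)"
            by (simp add: blinfun.diff_right)
          then have "norm (T t v - v) \<le> norm (T t (v - u n)) + norm (T t (u n) - u n) + norm (v - u n)"
            by (metis norm_triangle_ineq norm_triangle_ineq4 add_right_mono order_trans)
          also have "\<dots> < K * norm (v - u n) + e / 2 + norm (v - u n)"
            using Kx[of t "v - u n"] elim by (simp add: dist_norm)
          also have "\<dots> < e" using n by (simp add: algebra_simps)
          finally show ?case by (simp add: dist_norm)
        qed
      qed
    qed
  qed
  with y[of 0] have "((\<lambda>t. T t y) \<longlongrightarrow> y) (at_right 0)" by auto
  \<comment> \<open>The orbits of \<open>x\<close> and \<open>y\<close> coincide for positive times,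
    so the limit found for the orbit of \<open>y\<close> is the limit for that of
    \<open>x\<close>.\<close>
  then have *: "((\<lambda>t. T t x) \<longlongrightarrow> y) (at_right 0)"
    by (rule Lim_transform_eventually) (use Ty in \<open>auto simp: eventually_at_right[of 0 1] intro!: exI[of _ 1]\<close>)
  then have "T 0 x = y"
    unfolding lim by (intro tendsto_Lim) auto
  with * show ?thesis by simp
qed

text \<open>Every property at time 0 is the limit, as t decreases to 0, of the corresponding
  property at positive times.\<close>

lemma degenerate_semigroup_imp_operator_semigroup:
  fixes T :: "real \<Rightarrow> 'a::chilbert_space \<Rightarrow>\<^sub>L 'a"
  assumes T: "degenerate_semigroup T"
  shows "operator_semigroup T"
proof -
  have cont: "\<And>x. continuous_on {0<..} (\<lambda>t. T t x)"
    and add: "\<And>s t. t > 0 \<Longrightarrow> s > 0 \<Longrightarrow> T (t + s) = T t o\<^sub>L T s"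
    and LX: "\<And>t. t > 0 \<Longrightarrow> T t \<in> LX"
    using T by (auto simp: degenerate_semigroup_def)
  note lim = degenerate_semigroup_strong_limit[OF T]
  have pos: "\<forall>\<^sub>F t::real in at_right 0. 0 < t"
    by (auto simp: eventually_at_right[of 0 1] intro!: exI[of _ 1])
  have cont0: "continuous_on {0..} (\<lambda>t. T t x)" for x
    unfolding continuous_on_eq_continuous_within
  proof
    fix t :: real assume t: "t \<in> {0..}"
    show "continuous (at t within {0..}) (\<lambda>t. T t x)"
    proof (cases "t = 0")
      case True
      then show ?thesis
        using lim[of x] by (simp add: continuous_within at_within_Ici_at_right)
    next
      case False
      then have "isCont (\<lambda>t. T t x) t"
        using cont[of x] t by (simp add: continuous_on_eq_continuous_at open_greaterThan)
      then show ?thesis by (rule continuous_at_imp_continuous_at_within)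
    qed
  qed
  note lim_shift = degenerate_semigroup_tendsto_shift[OF T]
  have T0: "T 0 (T s x) = T s x" "T s (T 0 x) = T s x" if s: "s > 0" for s x
  proof -
    have "((\<lambda>t. T (s + t) x) \<longlongrightarrow> T 0 (T s x)) (at_right 0)"
      by (rule Lim_transform_eventually[OF lim], use pos in eventually_elim)
        (simp add: add s add.commute[of s])
    then show "T 0 (T s x) = T s x"
      using lim_shift[OF s] tendsto_unique[OF trivial_limit_at_right_real] by blast
    have "((\<lambda>t. T s (T t x)) \<longlongrightarrow> T s (T 0 x)) (at_right 0)"
      by (intro tendsto_intros lim)
    then have "((\<lambda>t. T (s + t) x) \<longlongrightarrow> T s (T 0 x)) (at_right 0)"
      by (rule Lim_transform_eventually, use pos in eventually_elim) (simp add: add s)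
    then show "T s (T 0 x) = T s x"
      using lim_shift[OF s] tendsto_unique[OF trivial_limit_at_right_real] by blast
  qed
  have T00: "T 0 (T 0 x) = T 0 x" for x
  proof -
    have "((\<lambda>t. T t x) \<longlongrightarrow> T 0 (T 0 x)) (at_right 0)"
      by (rule Lim_transform_eventually[OF lim], use pos in eventually_elim) (simp add: T0)
    then show ?thesis
      using lim tendsto_unique[OF trivial_limit_at_right_real] by blast
  qed
  have "T 0 (c *\<^sub>C x) = c *\<^sub>C T 0 x" for c x
  proof -
    have "((\<lambda>t. c *\<^sub>C T t x) \<longlongrightarrow> c *\<^sub>C T 0 x) (at_right 0)"
      by (intro scaleC.tendsto tendsto_const lim)
    then have "((\<lambda>t. T t (c *\<^sub>C x)) \<longlongrightarrow> c *\<^sub>C T 0 x) (at_right 0)"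
      by (rule Lim_transform_eventually, use pos in eventually_elim) (simp add: LX_apply[OF LX])
    then show ?thesis
      using lim tendsto_unique[OF trivial_limit_at_right_real] by blast
  qed
  then have "T 0 \<in> LX" by (simp add: LX_def)
  show ?thesis
  proof
    show "T t \<in> LX" if "0 \<le> t" for t
      using that LX \<open>T 0 \<in> LX\<close> by (cases "t = 0") auto
    show "T (s + t) = T s o\<^sub>L T t" if "0 \<le> s" "0 \<le> t" for s t
      using that T0 T00 add by (cases "s = 0"; cases "t = 0") (auto intro!: blinfun_eqI)
  qed (rule cont0)
qed

section \<open>Exponential growth bounds and Datko's theorem\<close>

context operator_semigroup
begin

lemma cont_on: "A \<subseteq> {0..} \<Longrightarrow> continuous_on A (\<lambda>t. T t x)"
  by (rule continuous_on_subset[OF cont])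

lemma add_apply: "0 \<le> s \<Longrightarrow> 0 \<le> t \<Longrightarrow> T s (T t x) = T (s + t) x"
  by (simp add: add)

text \<open>Orbits are bounded on compact intervals by continuity; uniform boundedness turns this
  into a bound on operator norms.\<close>

lemma bounded_on_interval: "\<exists>K. \<forall>t\<in>{0..a}. norm (T t) \<le> K"
proof (rule Banach_Steinhaus)
  fix x
  have "bounded ((\<lambda>t. T t x) ` {0..a})"
    by (intro compact_imp_bounded compact_continuous_image cont_on) auto
  then show "\<exists>C. \<forall>t\<in>{0..a}. norm (T t x) \<le> C"
    by (auto simp: bounded_iff)
qed

text \<open>Writing t = n t0 + r costs a factor q for each full period. The exact rate
  \<open>ln q / t0\<close> matters: it is negative when q < 1, and with q = exp (\<eta> t0) / 2 it
  lies strictly below \<eta>.\<close>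

lemma growth:
  assumes t0: "t0 > 0" and q: "q > 0" "norm (T t0) \<le> q"
  shows "\<exists>M>0. \<forall>t\<ge>0. norm (T t) \<le> M * exp (ln q / t0 * t)"
proof -
  obtain K0 where K0: "\<And>t. 0 \<le> t \<Longrightarrow> t \<le> t0 \<Longrightarrow> norm (T t) \<le> K0"
    using bounded_on_interval[of t0] by (metis atLeastAtMost_iff)
  define K where "K = max K0 1"
  have K: "norm (T t) \<le> K" if "0 \<le> t" "t \<le> t0" for t
    using K0[OF that] by (simp add: K_def)
  have K1: "K > 0" by (simp add: K_def)
  have step: "norm (T (real n * t0 + r)) \<le> q ^ n * K" if r: "0 \<le> r" "r \<le> t0" for n r
  proof (induction n)
    case 0
    then show ?case using K r by simp
  next
    case (Suc n)
    have "T (real (Suc n) * t0 + r) = T t0 o\<^sub>L T (real n * t0 + r)"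
      using add[of t0 "real n * t0 + r"] t0 r by (simp add: algebra_simps)
    then have "norm (T (real (Suc n) * t0 + r)) \<le> norm (T t0) * norm (T (real n * t0 + r))"
      by (simp add: norm_blinfun_compose)
    also have "\<dots> \<le> q * (q ^ n * K)"
      using Suc q by (intro mult_mono) auto
    finally show ?case by simp
  qed
  \<comment> \<open>The factor \<open>exp \<bar>ln q\<bar>\<close> absorbs the incomplete last
    period, whichever sign \<open>ln q\<close> has.\<close>
  have "norm (T t) \<le> (K * exp \<bar>ln q\<bar>) * exp (ln q / t0 * t)" if t: "t \<ge> 0" for t
  proof -
    define n where "n = nat \<lfloor>t / t0\<rfloor>"
    define r where "r = t - real n * t0"
    have n: "real n \<le> t / t0" "t / t0 < real n + 1"
      using t t0 by (auto simp: n_def)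
    then have r: "0 \<le> r" "r \<le> t0"
      using t0 by (auto simp: r_def field_simps)
    have "norm (T t) \<le> q ^ n * K"
      using step[OF r, of n] by (simp add: r_def)
    also have "q ^ n = exp (real n * ln q)"
      using q by (simp add: exp_of_nat_mult)
    also have "real n * ln q = ln q / t0 * t - ln q * (r / t0)"
      using t0 by (simp add: r_def field_simps)
    also have "exp \<dots> \<le> exp (ln q / t0 * t + \<bar>ln q\<bar>)"
    proof -
      have "\<bar>ln q * (r / t0)\<bar> \<le> \<bar>ln q\<bar> * 1"
        unfolding abs_mult using r t0 by (intro mult_left_mono) auto
      then have "- (ln q * (r / t0)) \<le> \<bar>ln q\<bar>"
        by linarith
      then show ?thesis by simp
    qed
    finally show ?thesis
      using K1 by (simp add: exp_add mult_right_mono mult.commute mult.left_commute)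
  qed
  then show ?thesis
    using K1 by (intro exI[of _ "K * exp \<bar>ln q\<bar>"]) auto
qed

lemma exponential_bound: "\<exists>M \<omega>. M > 0 \<and> \<omega> > 0 \<and> (\<forall>t\<ge>0. norm (T t) \<le> M * exp (\<omega> * t))"
proof -
  have "norm (T 1) \<le> norm (T 1) + exp 1" "norm (T 1) + exp 1 > (0::real)"
    by (auto intro!: add_nonneg_pos)
  from growth[OF zero_less_one this(2,1)]
  obtain M where "M > 0" "\<And>t. t \<ge> 0 \<Longrightarrow> norm (T t) \<le> M * exp (ln (norm (T 1) + exp 1) * t)"
    by auto
  moreover have "ln (norm (T 1) + exp 1) > 0"
    using norm_ge_zero[of "T 1"] exp_gt_one[of "1::real"] by (intro ln_gt_zero) linarith
  ultimately show ?thesis by blast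
qed

lemma exponentially_stable_if_contraction:
  assumes "t0 > 0" "norm (T t0) \<le> 1 / 2"
  shows "exponentially_stable T"
proof -
  obtain M where M: "M > 0" "\<And>t. t \<ge> 0 \<Longrightarrow> norm (T t) \<le> M * exp (ln (1/2) / t0 * t)"
    using growth[of t0 "1/2"] assms by auto
  have "- (ln 2 / t0) = ln (1/2) / t0" by (simp add: ln_div)
  then show ?thesis
    unfolding exponentially_stable_def
    using M assms by (intro exI[of _ M] exI[of _ "ln 2 / t0"] conjI allI impI) (auto simp: ln_gt_zero)
qed

lemma square_norm_integrable:
  "0 \<le> a \<Longrightarrow> (\<lambda>t. (norm (T t x))\<^sup>2) integrable_on {a..b}"
  by (intro integrable_continuous_interval continuous_intros cont_on) auto

text \<open>Averaging T t x = T (t - s) (T s x) over s in [t - 1, t] bounds the value at t by the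
  square integral over an interval of length 1. The term with \<open>norm x\<close> covers t \<le>
  1, where no such interval is available.\<close>

lemma pointwise_bound_of_square_integral:
  assumes K: "\<And>t. 0 \<le> t \<Longrightarrow> t \<le> 1 \<Longrightarrow> norm (T t) \<le> K"
    and C: "\<And>\<tau>. 0 \<le> \<tau> \<Longrightarrow> integral {0..\<tau>} (\<lambda>t. (norm (T t x))\<^sup>2) \<le> C"
    and t: "0 \<le> t"
  shows "(norm (T t x))\<^sup>2 \<le> K\<^sup>2 * (C + (norm x)\<^sup>2)"
proof (cases "t \<le> 1")
  case True
  have "norm (T t x) \<le> K * norm x"
    using norm_blinfun[of "T t" x] K[OF t True] by (meson mult_right_mono norm_ge_zero order_trans)
  then have "(norm (T t x))\<^sup>2 \<le> (K * norm x)\<^sup>2" by (intro power_mono) auto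
  also have "\<dots> \<le> K\<^sup>2 * (C + (norm x)\<^sup>2)"
    using C[of 0] by (simp add: power_mult_distrib algebra_simps)
  finally show ?thesis .
next
  case False
  have "norm (T t x) \<le> K * norm (T s x)" if s: "s \<in> {t - 1..t}" for s
  proof -
    have "T t x = T (t - s) (T s x)"
      using s False by (subst add_apply) auto
    then show ?thesis
      using norm_blinfun[of "T (t - s)" "T s x"] K[of "t - s"] s
      by (simp, meson mult_right_mono norm_ge_zero order_trans)
  qed
  then have "(norm (T t x))\<^sup>2 \<le> K\<^sup>2 * (norm (T s x))\<^sup>2" if "s \<in> {t - 1..t}" for s
    using that by (metis norm_ge_zero power_mono power_mult_distrib)
  then have "integral {t - 1..t} (\<lambda>s. (norm (T t x))\<^sup>2) \<le> integral {t - 1..t} (\<lambda>s. K\<^sup>2 * (norm (T s x))\<^sup>2)"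
    using False by (intro integral_le integrable_on_mult_right square_norm_integrable) auto
  then have "(norm (T t x))\<^sup>2 \<le> K\<^sup>2 * integral {t - 1..t} (\<lambda>s. (norm (T s x))\<^sup>2)"
    by simp
  also have "\<dots> \<le> K\<^sup>2 * integral {0..t} (\<lambda>s. (norm (T s x))\<^sup>2)"
    using False by (intro mult_left_mono integral_subset_le square_norm_integrable) auto
  also have "\<dots> \<le> K\<^sup>2 * (C + (norm x)\<^sup>2)"
    using C[OF t] by (intro mult_left_mono) (auto simp: add_increasing2)
  finally show ?thesis .
qed

text \<open>The same averaging over all of [0, t], possible once \<open>T\<close> is bounded, gains
  the factor t.\<close>

lemma decay_of_square_integral:
  assumes K: "\<And>t. 0 \<le> t \<Longrightarrow> norm (T t) \<le> K"
    and C: "\<And>\<tau>. 0 \<le> \<tau> \<Longrightarrow> integral {0..\<tau>} (\<lambda>t. (norm (T t x))\<^sup>2) \<le> C"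
    and t: "0 \<le> t"
  shows "t * (norm (T t x))\<^sup>2 \<le> K\<^sup>2 * C"
proof -
  have "norm (T t x) \<le> K * norm (T s x)" if s: "s \<in> {0..t}" for s
  proof -
    have "T t x = T (t - s) (T s x)"
      using s by (subst add_apply) auto
    then show ?thesis
      using norm_blinfun[of "T (t - s)" "T s x"] K[of "t - s"] s
      by (simp, meson mult_right_mono norm_ge_zero order_trans)
  qed
  then have "(norm (T t x))\<^sup>2 \<le> K\<^sup>2 * (norm (T s x))\<^sup>2" if "s \<in> {0..t}" for s
    using that by (metis norm_ge_zero power_mono power_mult_distrib)
  then have "integral {0..t} (\<lambda>s. (norm (T t x))\<^sup>2) \<le> integral {0..t} (\<lambda>s. K\<^sup>2 * (norm (T s x))\<^sup>2)"
    by (intro integral_le integrable_on_mult_right square_norm_integrable) auto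
  then have "t * (norm (T t x))\<^sup>2 \<le> K\<^sup>2 * integral {0..t} (\<lambda>s. (norm (T s x))\<^sup>2)"
    using t by simp
  also have "\<dots> \<le> K\<^sup>2 * C"
    using C[OF t] by (intro mult_left_mono) auto
  finally show ?thesis .
qed

text \<open>The two preceding estimates are combined: the first gives the global bound with square
  \<open>K\<^sup>2 * (C + 1)\<close>, the second the decay. What counts is that the admissible times
  are determined by \<open>K\<close> and \<open>C\<close> alone, so that one time serves a whole
  family of rescaled semigroups.\<close>

lemma Datko_quantitative:
  assumes K: "\<And>t. 0 \<le> t \<Longrightarrow> t \<le> 1 \<Longrightarrow> norm (T t) \<le> K"
    and C: "0 \<le> C" "\<And>x \<tau>. 0 \<le> \<tau> \<Longrightarrow> integral {0..\<tau>} (\<lambda>t. (norm (T t x))\<^sup>2) \<le> C * (norm x)\<^sup>2"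
    and t: "4 * (K\<^sup>2 * (C + 1) * C) \<le> t" "0 < t"
  shows "norm (T t) \<le> 1 / 2"
proof -
  define K2 where "K2 = sqrt (K\<^sup>2 * (C + 1))"
  have K2sq: "K2\<^sup>2 = K\<^sup>2 * (C + 1)"
    using C(1) by (simp add: K2_def)
  have K2: "norm (T s) \<le> K2" if s: "0 \<le> s" for s
  proof (rule norm_blinfun_bound)
    show "0 \<le> K2" using C(1) by (simp add: K2_def)
    fix x
    have "(norm (T s x))\<^sup>2 \<le> K\<^sup>2 * (C * (norm x)\<^sup>2 + (norm x)\<^sup>2)"
      by (rule pointwise_bound_of_square_integral[OF K C(2) s])
    also have "\<dots> = (K2 * norm x)\<^sup>2"
      by (simp add: power_mult_distrib K2sq algebra_simps)
    finally show "norm (T s x) \<le> K2 * norm x"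
      by (rule power2_le_imp_le) (use \<open>0 \<le> K2\<close> in simp)
  qed
  show ?thesis
  proof (rule norm_blinfun_bound)
    fix x
    have "t * (norm (T t x))\<^sup>2 \<le> K2\<^sup>2 * (C * (norm x)\<^sup>2)"
      by (rule decay_of_square_integral[OF K2 C(2)]) (use t in auto)
    also have "\<dots> = (4 * (K\<^sup>2 * (C + 1) * C)) * ((norm x)\<^sup>2 / 4)"
      by (simp add: K2sq)
    also have "\<dots> \<le> t * ((norm x)\<^sup>2 / 4)"
      using t by (intro mult_right_mono) auto
    finally have "(norm (T t x))\<^sup>2 \<le> (1 / 2 * norm x)\<^sup>2"
      using t by (simp add: power_mult_distrib power_divide)
    then show "norm (T t x) \<le> 1 / 2 * norm x"
      by (rule power2_le_imp_le) simp
  qed simp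
qed

text \<open>The bound depends on x, so uniform boundedness is applied twice: to the operators T t,
  and then to sqrt t T t, which makes norm (T t) decay like 1 / sqrt t.\<close>

theorem Datko:
  assumes C: "\<And>x. \<exists>C. \<forall>\<tau>\<ge>0. integral {0..\<tau>} (\<lambda>t. (norm (T t x))\<^sup>2) \<le> C"
  shows "exponentially_stable T"
proof -
  obtain K where K: "\<And>t. 0 \<le> t \<Longrightarrow> t \<le> 1 \<Longrightarrow> norm (T t) \<le> K"
    using bounded_on_interval[of 1] by (metis atLeastAtMost_iff)
  have "\<exists>K. \<forall>t\<in>{0..}. norm (T t) \<le> K"
  proof (rule Banach_Steinhaus)
    fix x
    obtain c where c: "\<forall>\<tau>\<ge>0. integral {0..\<tau>} (\<lambda>t. (norm (T t x))\<^sup>2) \<le> c"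
      using C by blast
    then have "norm (T t x) \<le> sqrt (K\<^sup>2 * (c + (norm x)\<^sup>2))" if "0 \<le> t" for t
      using pointwise_bound_of_square_integral[of K, OF K _ that] by (intro real_le_rsqrt) auto
    then show "\<exists>C. \<forall>t\<in>{0..}. norm (T t x) \<le> C" by auto
  qed
  then obtain K2 where K2: "\<And>t. 0 \<le> t \<Longrightarrow> norm (T t) \<le> K2" by auto
  have "\<exists>K. \<forall>t\<in>{0..}. norm (sqrt t *\<^sub>R T t) \<le> K"
  proof (rule Banach_Steinhaus)
    fix x
    obtain c where c: "\<forall>\<tau>\<ge>0. integral {0..\<tau>} (\<lambda>t. (norm (T t x))\<^sup>2) \<le> c"
      using C by blast
    have "norm ((sqrt t *\<^sub>R T t) x) \<le> sqrt (K2\<^sup>2 * c)" if t: "0 \<le> t" for t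
    proof (rule real_le_rsqrt)
      show "(norm ((sqrt t *\<^sub>R T t) x))\<^sup>2 \<le> K2\<^sup>2 * c"
        using decay_of_square_integral[of K2 x c t, OF K2] c t
        by (simp add: blinfun.scaleR_left power_mult_distrib)
    qed
    then show "\<exists>C. \<forall>t\<in>{0..}. norm ((sqrt t *\<^sub>R T t) x) \<le> C" by auto
  qed
  then obtain K3 where K3: "\<And>t. 0 \<le> t \<Longrightarrow> sqrt t * norm (T t) \<le> K3" by auto
  \<comment> \<open>Large enough that \<open>K3 / sqrt t \<le> 1 / 2\<close>; the added 1 keeps t
    positive.\<close>
  define t where "t = (2 * (\<bar>K3\<bar> + 1))\<^sup>2"
  have t: "t > 0" "sqrt t = 2 * (\<bar>K3\<bar> + 1)" unfolding t_def by auto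
  have "norm (T t) \<le> K3 / sqrt t"
    using K3[of t] t by (simp add: field_simps)
  also have "\<dots> \<le> 1 / 2"
    using t by (simp add: field_simps)
  finally show ?thesis
    using t exponentially_stable_if_contraction by blast
qed

end

subsection \<open>Laplace transforms and resolvents\<close>

declare scaleC.zero_left [simp] scaleC.zero_right [simp]

text \<open>Cauchy criterion for improper integrals: \<open>e a\<close> controls all increments
  beyond a, uniformly in the upper limit. It yields both the Laplace transform and the quadratic
  form behind the Lyapunov operator.\<close>

lemma tendsto_at_top_if_increments_tendsto_zero:
  fixes F :: "real \<Rightarrow> 'b::banach"
  assumes F: "\<And>a b. 0 \<le> a \<Longrightarrow> a \<le> b \<Longrightarrow> norm (F b - F a) \<le> e a" and e: "(e \<longlongrightarrow> 0) at_top"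
  shows "\<exists>l. (F \<longlongrightarrow> l) at_top"
proof -
  have small: "\<exists>a\<ge>0. e a < r" if r: "0 < r" for r
  proof -
    have "\<forall>\<^sub>F a in at_top. 0 \<le> a \<and> e a < r"
      using order_tendstoD(2)[OF e r] eventually_ge_at_top[of 0] by eventually_elim auto
    then show ?thesis
      using eventually_happens'[OF trivial_limit_at_top_linorder] by blast
  qed
  have near: "dist (F b) (F c) < r" if "0 \<le> a" "e a < r / 2" "a \<le> b" "a \<le> c" for a b c r
    using F[of a b] F[of a c] dist_triangle2[of "F b" "F c" "F a"] that by (simp add: dist_norm)
  have "Cauchy (\<lambda>n. F (real n))"
  proof (rule metric_CauchyI)
    fix r :: real assume "0 < r"
    then obtain a where a: "a \<ge> 0" "e a < r / 2" using small[of "r / 2"] by auto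
    obtain N where "a \<le> real N" using real_arch_simple by blast
    then show "\<exists>M. \<forall>m\<ge>M. \<forall>n\<ge>M. dist (F (real m)) (F (real n)) < r"
      by (intro exI[of _ N] allI impI near[OF a]) linarith+
  qed
  then obtain l where l: "(\<lambda>n. F (real n)) \<longlonglongrightarrow> l"
    using Cauchy_convergent convergent_def by blast
  have "(F \<longlongrightarrow> l) at_top"
  proof (rule tendstoI)
    fix r :: real assume r: "0 < r"
    then obtain a where a: "a \<ge> 0" "e a < (r / 2) / 2" using small[of "r / 2 / 2"] by auto
    obtain N where N: "a \<le> real N" using real_arch_simple by blast
    obtain n where n: "N \<le> n" "dist (F (real n)) l < r / 2"
      using tendstoD[OF l, of "r / 2"] r
      by (metis (no_types, lifting) eventually_sequentially half_gt_zero linear order_refl)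
    have "dist (F b) l < r" if "a \<le> b" for b
      using near[OF a that, of "real n"] n N dist_triangle[of "F b" l "F (real n)"] by simp
    then show "\<forall>\<^sub>F b in at_top. dist (F b) l < r"
      by (auto simp: eventually_at_top_linorder)
  qed
  then show ?thesis by blast
qed

lemma has_integral_exp_neg:
  fixes \<kappa> :: real
  assumes "\<kappa> \<noteq> 0" "a \<le> b"
  shows "((\<lambda>t. exp (- \<kappa> * t)) has_integral (exp (- \<kappa> * a) - exp (- \<kappa> * b)) / \<kappa>) {a..b}"
proof -
  have "((\<lambda>t. exp (- \<kappa> * t)) has_integral - exp (- \<kappa> * b) / \<kappa> - (- exp (- \<kappa> * a) / \<kappa>)) {a..b}"
    by (rule fundamental_theorem_of_calculus[OF assms(2)])
      (use assms in \<open>auto intro!: derivative_eq_intros simp flip: has_real_derivative_iff_has_vector_derivative\<close>)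
  then show ?thesis by (simp add: diff_divide_distrib)
qed

lemma tendsto_exp_neg_at_top: "\<kappa> > 0 \<Longrightarrow> ((\<lambda>t. exp (- \<kappa> * t)) \<longlongrightarrow> 0) at_top" for \<kappa> :: real
  by real_asymp

text \<open>The rate \<open>\<omega>\<close> may have either sign, and one semigroup is used with
  several pairs of constants.\<close>

locale bounded_operator_semigroup = operator_semigroup +
  fixes M \<omega> :: real
  assumes M_pos: "0 < M"
    and bound: "0 \<le> t \<Longrightarrow> norm (T t) \<le> M * exp (\<omega> * t)"
begin

lemma norm_apply_le: "0 \<le> t \<Longrightarrow> norm (T t x) \<le> M * exp (\<omega> * t) * norm x"
  using norm_blinfun[of "T t" x] bound[of t] by (meson mult_right_mono norm_ge_zero order_trans)

definition damped :: "complex \<Rightarrow> 'a \<Rightarrow> real \<Rightarrow> 'a"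
  where "damped z x t = exp (- z * of_real t) *\<^sub>C T t x"

lemma continuous_damped: "A \<subseteq> {0..} \<Longrightarrow> continuous_on A (damped z x)"
  unfolding damped_def by (intro scaleC.continuous_on continuous_intros cont_on)

lemma integrable_damped: "0 \<le> a \<Longrightarrow> damped z x integrable_on {a..b}"
  by (intro integrable_continuous_interval continuous_damped) auto

lemma integral_linear_damped:
  assumes "0 \<le> a" "bounded_linear h"
  shows "integral {a..b} (\<lambda>t. h (damped z x t)) = h (integral {a..b} (damped z x))"
  using integral_linear[OF integrable_damped assms(2)] assms(1) by (simp add: o_def)

lemma norm_damped: "0 \<le> t \<Longrightarrow> norm (damped z x t) \<le> M * norm x * exp (- (Re z - \<omega>) * t)"
proof -
  assume t: "0 \<le> t"
  have "norm (damped z x t) = exp (- Re z * t) * norm (T t x)"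
    by (simp add: damped_def norm_scaleC)
  also have "\<dots> \<le> exp (- Re z * t) * (M * exp (\<omega> * t) * norm x)"
    by (intro mult_left_mono norm_apply_le t) auto
  also have "\<dots> = M * norm x * exp (- Re z * t + \<omega> * t)"
    by (simp only: exp_add mult_ac)
  also have "- Re z * t + \<omega> * t = - (Re z - \<omega>) * t"
    by (simp add: algebra_simps)
  finally show ?thesis .
qed

lemma norm_integral_damped:
  assumes z: "\<omega> < Re z" and ab: "0 \<le> a" "a \<le> b"
  shows "norm (integral {a..b} (damped z x)) \<le> M * norm x / (Re z - \<omega>) * exp (- (Re z - \<omega>) * a)"
proof -
  let ?\<kappa> = "Re z - \<omega>"
  note hi = has_integral_mult_right[OF has_integral_exp_neg[of ?\<kappa> a b], of "M * norm x"]
  have "norm (integral {a..b} (damped z x)) \<le> integral {a..b} (\<lambda>t. M * norm x * exp (- ?\<kappa> * t))"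
    using ab z hi norm_damped
    by (intro integral_norm_bound_integral integrable_damped) (auto simp: integrable_on_def)
  also have "\<dots> = M * norm x * ((exp (- ?\<kappa> * a) - exp (- ?\<kappa> * b)) / ?\<kappa>)"
    using hi z ab by (intro integral_unique) auto
  also have "\<dots> \<le> M * norm x * (exp (- ?\<kappa> * a) / ?\<kappa>)"
    using z M_pos by (intro mult_left_mono divide_right_mono) auto
  finally show ?thesis by simp
qed

lemma damped_add: "damped z (x + y) = (\<lambda>t. damped z x t + damped z y t)"
  and damped_scaleR: "damped z (r *\<^sub>R x) = (\<lambda>t. r *\<^sub>R damped z x t)"
  by (auto simp: damped_def blinfun.add_right scaleC_add_right blinfun.scaleR_right scaleC.scaleR_right)

text \<open>Minus the Laplace transform, the sign that matches the resolvent identity of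
  \<open>pseudo_resolvent\<close>. \<open>Blinfun\<close> gives the intended operator for Re z >
  \<omega>, where the limits exist and depend on x in a bounded linear way.\<close>

definition laplace :: "complex \<Rightarrow> 'a \<Rightarrow>\<^sub>L 'a"
  where "laplace z = Blinfun (\<lambda>x. Lim at_top (\<lambda>\<tau>. - integral {0..\<tau>} (damped z x)))"

lemma laplace_bounded_linear:
  fixes f
  assumes z: "\<omega> < Re z"
  defines "f \<equiv> \<lambda>x. Lim at_top (\<lambda>\<tau>. - integral {0..\<tau>} (damped z x))"
  shows "\<forall>x. ((\<lambda>\<tau>. - integral {0..\<tau>} (damped z x)) \<longlongrightarrow> f x) at_top"
    and "bounded_linear f"
    and "\<forall>x. norm (f x) \<le> M / (Re z - \<omega>) * norm x"
proof -
  have lim: "((\<lambda>\<tau>. - integral {0..\<tau>} (damped z x)) \<longlongrightarrow> f x) at_top" for x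
  proof -
    have "\<exists>l. ((\<lambda>\<tau>. - integral {0..\<tau>} (damped z x)) \<longlongrightarrow> l) at_top"
    proof (rule tendsto_at_top_if_increments_tendsto_zero
        [where e = "\<lambda>a. M * norm x / (Re z - \<omega>) * exp (- (Re z - \<omega>) * a)"])
      fix a b :: real assume ab: "0 \<le> a" "a \<le> b"
      have "integral {0..a} (damped z x) + integral {a..b} (damped z x) = integral {0..b} (damped z x)"
        using ab by (intro Henstock_Kurzweil_Integration.integral_combine integrable_damped) auto
      then have "- integral {0..b} (damped z x) - - integral {0..a} (damped z x) = - integral {a..b} (damped z x)"
        by (simp add: algebra_simps)
      then show "norm (- integral {0..b} (damped z x) - - integral {0..a} (damped z x))
          \<le> M * norm x / (Re z - \<omega>) * exp (- (Re z - \<omega>) * a)"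
        using norm_integral_damped[OF z ab, of x] by simp
    next
      show "((\<lambda>a. M * norm x / (Re z - \<omega>) * exp (- (Re z - \<omega>) * a)) \<longlongrightarrow> 0) at_top"
        using tendsto_exp_neg_at_top[of "Re z - \<omega>"] z by (intro tendsto_mult_right_zero) auto
    qed
    then show ?thesis
      unfolding f_def by (metis tendsto_Lim trivial_limit_at_top_linorder)
  qed
  have norm: "norm (f x) \<le> M / (Re z - \<omega>) * norm x" for x
  proof (rule tendsto_upperbound)
    show "((\<lambda>\<tau>. norm (- integral {0..\<tau>} (damped z x))) \<longlongrightarrow> norm (f x)) at_top"
      by (intro tendsto_norm lim)
    show "\<forall>\<^sub>F \<tau> in at_top. norm (- integral {0..\<tau>} (damped z x)) \<le> M / (Re z - \<omega>) * norm x"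
      using eventually_ge_at_top[of 0]
      by eventually_elim (use norm_integral_damped[OF z order_refl, of _ x] in simp)
  qed simp
  show "\<forall>x. ((\<lambda>\<tau>. - integral {0..\<tau>} (damped z x)) \<longlongrightarrow> f x) at_top"
    "\<forall>x. norm (f x) \<le> M / (Re z - \<omega>) * norm x"
    using lim norm by blast+
  have uniq: "f y = l" if "((\<lambda>\<tau>. - integral {0..\<tau>} (damped z y)) \<longlongrightarrow> l) at_top" for y l
    using tendsto_unique[OF _ lim that] by simp
  show "bounded_linear f"
  proof (rule bounded_linear_intro[where K = "M / (Re z - \<omega>)"])
    fix x y and r :: real
    show "f (x + y) = f x + f y"
    proof (rule uniq)
      have "((\<lambda>\<tau>. - integral {0..\<tau>} (damped z x) + - integral {0..\<tau>} (damped z y)) \<longlongrightarrow> f x + f y) at_top"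
        by (intro tendsto_add lim)
      then show "((\<lambda>\<tau>. - integral {0..\<tau>} (damped z (x + y))) \<longlongrightarrow> f x + f y) at_top"
        by (simp add: damped_add integral_add integrable_damped)
    qed
    show "f (r *\<^sub>R x) = r *\<^sub>R f x"
    proof (rule uniq)
      have "((\<lambda>\<tau>. r *\<^sub>R (- integral {0..\<tau>} (damped z x))) \<longlongrightarrow> r *\<^sub>R f x) at_top"
        by (intro tendsto_intros lim)
      then show "((\<lambda>\<tau>. - integral {0..\<tau>} (damped z (r *\<^sub>R x))) \<longlongrightarrow> r *\<^sub>R f x) at_top"
        by (simp add: damped_scaleR)
    qed
    show "norm (f x) \<le> norm x * (M / (Re z - \<omega>))"
      using norm[of x] by (simp add: mult.commute)
  qed
qed

context
  fixes z :: complex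
  assumes z: "\<omega> < Re z"
begin

lemma laplace_apply: "laplace z x = Lim at_top (\<lambda>\<tau>. - integral {0..\<tau>} (damped z x))"
  unfolding laplace_def using laplace_bounded_linear(2)[OF z] by (simp add: bounded_linear_Blinfun_apply)

lemma laplace_lim: "((\<lambda>\<tau>. - integral {0..\<tau>} (damped z x)) \<longlongrightarrow> laplace z x) at_top"
  unfolding laplace_apply using laplace_bounded_linear(1)[OF z] by blast

lemma laplace_eqI: "((\<lambda>\<tau>. - integral {0..\<tau>} (damped z x)) \<longlongrightarrow> l) at_top \<Longrightarrow> laplace z x = l"
  using tendsto_unique[OF _ laplace_lim] by simp

lemma norm_laplace: "norm (laplace z) \<le> M / (Re z - \<omega>)"
  by (rule norm_blinfun_bound)
    (use z M_pos laplace_bounded_linear(3)[OF z] laplace_apply in auto)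

lemma laplace_in_LX: "laplace z \<in> LX"
proof -
  have "laplace z (c *\<^sub>C x) = c *\<^sub>C laplace z x" for c x
  proof (rule laplace_eqI)
    have "((\<lambda>\<tau>. c *\<^sub>C (- integral {0..\<tau>} (damped z x))) \<longlongrightarrow> c *\<^sub>C laplace z x) at_top"
      by (intro scaleC.tendsto tendsto_const laplace_lim)
    moreover have "c *\<^sub>C (- integral {0..\<tau>} (damped z x)) = - integral {0..\<tau>} (damped z (c *\<^sub>C x))" for \<tau>
    proof -
      have "integral {0..\<tau>} (damped z (c *\<^sub>C x)) = integral {0..\<tau>} (\<lambda>t. c *\<^sub>C damped z x t)"
        by (rule integral_cong) (simp add: damped_def LX_apply[OF in_LX] scaleC_scaleC mult.commute)
      then show ?thesis
        by (simp add: integral_linear_damped[OF _ bounded_linear_scaleC] scaleC.minus_right)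
    qed
    ultimately show "((\<lambda>\<tau>. - integral {0..\<tau>} (damped z (c *\<^sub>C x))) \<longlongrightarrow> c *\<^sub>C laplace z x) at_top"
      by simp
  qed
  then show ?thesis by (simp add: LX_def)
qed

lemma laplace_commute:
  assumes s: "0 \<le> s"
  shows "T s (laplace z x) = laplace z (T s x)"
proof (rule laplace_eqI[symmetric])
  have "((\<lambda>\<tau>. T s (- integral {0..\<tau>} (damped z x))) \<longlongrightarrow> T s (laplace z x)) at_top"
    by (intro tendsto_intros laplace_lim)
  moreover have "T s (- integral {0..\<tau>} (damped z x)) = - integral {0..\<tau>} (damped z (T s x))" for \<tau>
  proof -
    have "integral {0..\<tau>} (damped z (T s x)) = integral {0..\<tau>} (\<lambda>t. T s (damped z x t))"
      using s by (intro integral_cong)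
        (simp add: damped_def LX_apply[OF in_LX] add_apply add.commute)
    then show ?thesis
      by (simp add: integral_linear_damped[OF _ blinfun.bounded_linear_right] blinfun.minus_right)
  qed
  ultimately show "((\<lambda>\<tau>. - integral {0..\<tau>} (damped z (T s x))) \<longlongrightarrow> T s (laplace z x)) at_top"
    by simp
qed

text \<open>Shifting the variable by s removes the piece over [0, s] from the Laplace integral. The
  formula exhibits the orbit of \<open>laplace z x\<close> as an exponential times a primitive of a
  continuous function, so the orbit is differentiable.\<close>

lemma semigroup_laplace:
  assumes s: "0 \<le> s"
  shows "T s (laplace z x) = exp (z * of_real s) *\<^sub>C (laplace z x + integral {0..s} (damped z x))"
proof -
  have "((\<lambda>\<tau>. integral {0..s} (damped z x) + - integral {0..\<tau> + s} (damped z x)) \<longlongrightarrow>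
      integral {0..s} (damped z x) + laplace z x) at_top"
    by (intro tendsto_add tendsto_const filterlim_compose[OF laplace_lim]) real_asymp
  moreover have "\<forall>\<^sub>F \<tau> in at_top. integral {0..s} (damped z x) + - integral {0..\<tau> + s} (damped z x)
      = exp (- z * of_real s) *\<^sub>C (- integral {0..\<tau>} (damped z (T s x)))"
    using eventually_ge_at_top[of 0]
  proof eventually_elim
    case (elim \<tau>)
    have "integral {0..s} (damped z x) + integral {s..\<tau> + s} (damped z x) = integral {0..\<tau> + s} (damped z x)"
      using s elim by (intro Henstock_Kurzweil_Integration.integral_combine integrable_damped) auto
    moreover have "integral {0 + s..\<tau> + s} (damped z x)
        = integral {0..\<tau>} (\<lambda>t. exp (- z * of_real s) *\<^sub>C damped z (T s x) t)"
      using s unfolding integral_shift_Icc_real[symmetric]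
      by (intro integral_cong)
        (simp add: damped_def scaleC_scaleC add_apply distrib_left add.commute flip: exp_add)
    moreover have "\<dots> = exp (- z * of_real s) *\<^sub>C integral {0..\<tau>} (damped z (T s x))"
      by (rule integral_linear_damped[OF _ bounded_linear_scaleC]) simp
    ultimately show ?case
      by (simp add: scaleC.minus_right algebra_simps)
  qed
  ultimately have "((\<lambda>\<tau>. exp (- z * of_real s) *\<^sub>C (- integral {0..\<tau>} (damped z (T s x))))
      \<longlongrightarrow> integral {0..s} (damped z x) + laplace z x) at_top"
    by (rule Lim_transform_eventually)
  moreover have "((\<lambda>\<tau>. exp (- z * of_real s) *\<^sub>C (- integral {0..\<tau>} (damped z (T s x))))
      \<longlongrightarrow> exp (- z * of_real s) *\<^sub>C laplace z (T s x)) at_top"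
    by (intro scaleC.tendsto tendsto_const laplace_lim)
  ultimately have "integral {0..s} (damped z x) + laplace z x = exp (- z * of_real s) *\<^sub>C T s (laplace z x)"
    using tendsto_unique[OF trivial_limit_at_top_linorder] s by (metis laplace_commute)
  then show ?thesis
    by (simp add: scaleC_scaleC add.commute flip: exp_add)
qed

lemma semigroup_zero_laplace: "T 0 (laplace z x) = laplace z x"
  using semigroup_laplace[of 0 x] by simp

text \<open>Product rule for \<open>semigroup_laplace\<close>. It expresses that
  \<open>laplace z x\<close> lies in the domain of the generator, without introducing the
  generator.\<close>

lemma has_vector_derivative_laplace:
  assumes t: "t \<in> {0..b}"
  shows "((\<lambda>t. T t (laplace z x)) has_vector_derivative (z *\<^sub>C T t (laplace z x) + T t x)) (at t within {0..b})"
proof -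
  let ?E = "\<lambda>t. exp (z * complex_of_real t)"
  let ?I = "\<lambda>t. laplace z x + integral {0..t} (damped z x)"
  have E: "(?E has_vector_derivative z * ?E t) (at t within {0..b})"
    by (rule has_vector_derivative_real_field) (auto intro!: derivative_eq_intros)
  have "((\<lambda>u. integral {0..u} (damped z x)) has_vector_derivative damped z x t) (at t within {0..b})"
    using t by (intro integral_has_vector_derivative continuous_damped) auto
  then have I: "(?I has_vector_derivative damped z x t) (at t within {0..b})"
    by (auto intro!: derivative_eq_intros)
  have "((\<lambda>t. ?E t *\<^sub>C ?I t) has_vector_derivative (?E t *\<^sub>C damped z x t + (z * ?E t) *\<^sub>C ?I t))
      (at t within {0..b})"
    by (rule scaleC.has_vector_derivative[OF E I])
  moreover have "?E t *\<^sub>C damped z x t + (z * ?E t) *\<^sub>C ?I t = z *\<^sub>C T t (laplace z x) + T t x"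
    using t by (simp add: damped_def semigroup_laplace scaleC_scaleC flip: exp_add)
  ultimately show ?thesis
    by (metis (no_types, lifting) atLeastAtMost_iff has_vector_derivative_transform semigroup_laplace t)
qed

end

text \<open>The function ?v t = exp (-z t) T t (laplace w x) has an explicit derivative. Integrating
  it over [0, b] and letting b go to infinity leaves only the boundary value at 0, so no double
  integral arises.\<close>

lemma laplace_resolvent:
  assumes z: "\<omega> < Re z" and w: "\<omega> < Re w"
  shows "laplace z - laplace w = (z - w) *\<^sub>C (laplace z o\<^sub>L laplace w)"
proof (rule blinfun_eqI)
  fix x
  let ?u = "\<lambda>t. T t (laplace w x)"
  let ?v = "damped z (laplace w x)"
  have v': "(?v has_vector_derivative ((w - z) *\<^sub>C ?v t + damped z x t)) (at t within {0..b})"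
    if t: "t \<in> {0..b}" for t b
  proof -
    have "((\<lambda>t. exp (- z * complex_of_real t)) has_vector_derivative (- z * exp (- z * complex_of_real t)))
        (at t within {0..b})"
      by (rule has_vector_derivative_real_field) (auto intro!: derivative_eq_intros)
    note scaleC.has_vector_derivative[OF this has_vector_derivative_laplace[OF w t, of x]]
    then show ?thesis
      unfolding damped_def[abs_def] by (rule has_vector_derivative_eq_rhs)
        (simp add: damped_def scaleC_add_right scaleC_scaleC scaleC.diff_left scaleC.minus_left left_diff_distrib mult.commute)
  qed
  have FTC: "?v b - ?v 0 = (w - z) *\<^sub>C integral {0..b} ?v + integral {0..b} (damped z x)" if "0 \<le> b" for b
  proof -
    have "((\<lambda>t. (w - z) *\<^sub>C ?v t + damped z x t) has_integral (?v b - ?v 0)) {0..b}"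
      by (rule fundamental_theorem_of_calculus[OF that v'])
    moreover have "((\<lambda>t. (w - z) *\<^sub>C ?v t + damped z x t) has_integral
        ((w - z) *\<^sub>C integral {0..b} ?v + integral {0..b} (damped z x))) {0..b}"
      by (intro has_integral_add integrable_integral integrable_damped order_refl
          has_integral_linear[OF integrable_integral[OF integrable_damped[OF order_refl]] bounded_linear_scaleC,
            unfolded o_def])
    ultimately show ?thesis by (rule has_integral_unique)
  qed
  have v0: "?v 0 = laplace w x"
    using semigroup_zero_laplace[OF w] by (simp add: damped_def)
  have "(?v \<longlongrightarrow> 0) at_top"
  proof (rule Lim_null_comparison)
    show "\<forall>\<^sub>F t in at_top. norm (?v t) \<le> M * norm (laplace w x) * exp (- (Re z - \<omega>) * t)"
      using eventually_ge_at_top[of 0] by eventually_elim (rule norm_damped)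
    show "((\<lambda>t. M * norm (laplace w x) * exp (- (Re z - \<omega>) * t)) \<longlongrightarrow> 0) at_top"
      using tendsto_exp_neg_at_top[of "Re z - \<omega>"] z by (intro tendsto_mult_right_zero) auto
  qed
  then have "((\<lambda>b. laplace w x - ?v b) \<longlongrightarrow> laplace w x - 0) at_top"
    by (intro tendsto_intros)
  then have "((\<lambda>b. (w - z) *\<^sub>C (- integral {0..b} ?v) + - integral {0..b} (damped z x)) \<longlongrightarrow> laplace w x - 0) at_top"
  proof (rule Lim_transform_eventually)
    show "\<forall>\<^sub>F b in at_top. laplace w x - ?v b
        = (w - z) *\<^sub>C (- integral {0..b} ?v) + - integral {0..b} (damped z x)"
      using eventually_ge_at_top[of 0]
    proof eventually_elim
      case (elim b)
      have "?v b = laplace w x + ((w - z) *\<^sub>C integral {0..b} ?v + integral {0..b} (damped z x))"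
        using FTC[OF elim] v0 by (metis add_diff_cancel_left' diff_add_cancel add.commute)
      then show ?case by (simp add: scaleC.minus_right)
    qed
  qed
  moreover have "((\<lambda>b. (w - z) *\<^sub>C (- integral {0..b} ?v) + - integral {0..b} (damped z x))
      \<longlongrightarrow> (w - z) *\<^sub>C laplace z (laplace w x) + laplace z x) at_top"
    by (intro tendsto_add scaleC.tendsto tendsto_const laplace_lim z)
  ultimately have "laplace w x = (w - z) *\<^sub>C laplace z (laplace w x) + laplace z x"
    using tendsto_unique[OF trivial_limit_at_top_linorder] by fastforce
  then show "(laplace z - laplace w) x = ((z - w) *\<^sub>C (laplace z o\<^sub>L laplace w)) x"
    by (simp add: blinfun.diff_left scaleC.diff_left algebra_simps)
qed

lemma pseudo_resolvent_laplace: "pseudo_resolvent {z. \<omega> < Re z} laplace"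
  by (simp add: pseudo_resolvent_def laplace_in_LX laplace_resolvent)

lemma extends_laplace_transform_laplace: "extends_laplace_transform T {z. \<omega> < Re z} laplace"
  unfolding extends_laplace_transform_def by (intro exI[of _ \<omega>]) (use laplace_lim in \<open>auto simp: damped_def[abs_def]\<close>)

end

section \<open>Pseudo-resolvents that extend the Laplace transform\<close>

locale semigroup_resolvent = bounded_operator_semigroup +
  fixes \<Omega> and R
  assumes pseudo: "pseudo_resolvent \<Omega> R" and extends: "extends_laplace_transform T \<Omega> R"
begin

lemma R_LX: "z \<in> \<Omega> \<Longrightarrow> R z \<in> LX"
  and R_resolvent: "z \<in> \<Omega> \<Longrightarrow> w \<in> \<Omega> \<Longrightarrow> R z - R w = (z - w) *\<^sub>C (R z o\<^sub>L R w)"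
  using pseudo by (auto simp: pseudo_resolvent_def)

lemma R_resolvent_apply: "z \<in> \<Omega> \<Longrightarrow> w \<in> \<Omega> \<Longrightarrow> R z x = R w x + (z - w) *\<^sub>C R z (R w x)"
  using arg_cong[OF R_resolvent[of z w], of "\<lambda>A. blinfun_apply A x"]
  by (simp add: blinfun.diff_left algebra_simps)

text \<open>With \<open>R w\<close> in front, the identity shows that every \<open>R z x\<close>
  lies in the range of \<open>R w\<close>. Regularity of orbits thereby passes from
  \<open>laplace w\<close>, for one w far to the right, to \<open>R z\<close> for all z in
  \<open>\<Omega>\<close>.\<close>

lemma R_resolvent_apply': "z \<in> \<Omega> \<Longrightarrow> w \<in> \<Omega> \<Longrightarrow> R z x = R w (x + (z - w) *\<^sub>C R z x)"
  using R_resolvent_apply[of w z x]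
  by (simp add: blinfun.add_right blinfun.diff_right LX_apply[OF R_LX] scaleC.diff_left algebra_simps)

text \<open>The abscissa hidden in \<open>extends_laplace_transform\<close> may exceed
  \<open>\<omega>\<close>; w is taken to the right of both.\<close>

lemma obtain_large:
  obtains w where "w \<in> \<Omega>" "\<omega> < Re w" "R w = laplace w"
proof -
  obtain \<omega>' where \<omega>': "\<And>z. \<omega>' < Re z \<Longrightarrow> z \<in> \<Omega> \<and>
      (\<forall>x. ((\<lambda>\<tau>. - integral {0..\<tau>} (damped z x)) \<longlongrightarrow> R z x) at_top)"
    using extends unfolding extends_laplace_transform_def damped_def[abs_def] by blast
  define w where "w = complex_of_real (max \<omega> \<omega>' + 1)"
  have "\<omega> < Re w" "\<omega>' < Re w" by (auto simp: w_def)
  then show thesis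
    using that[of w] \<omega>'[of w] laplace_eqI[of w] by (metis blinfun_eqI)
qed

text \<open>The defect \<open>?e\<close> satisfies (z - w) R w ?e = ?e. Inserting this into the
  resolvent identity cancels \<open>R z ?e\<close> and leaves R w ?e = 0, whence ?e = 0.\<close>

lemma R_commute:
  assumes z: "z \<in> \<Omega>" and t: "0 \<le> t"
  shows "T t (R z x) = R z (T t x)"
proof -
  obtain w where w: "w \<in> \<Omega>" "\<omega> < Re w" "R w = laplace w" by (rule obtain_large)
  let ?e = "T t (R z x) - R z (T t x)"
  have "T t (R z x) = R w (T t x + (z - w) *\<^sub>C T t (R z x))"
    using R_resolvent_apply'[OF z w(1), of x] laplace_commute[OF w(2) t]
    by (metis w(3) blinfun.add_right LX_apply in_LX t)
  moreover have "R z (T t x) = R w (T t x + (z - w) *\<^sub>C R z (T t x))"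
    by (rule R_resolvent_apply'[OF z w(1)])
  ultimately have "?e = R w (T t x + (z - w) *\<^sub>C T t (R z x)) - R w (T t x + (z - w) *\<^sub>C R z (T t x))"
    by simp
  also have "\<dots> = (z - w) *\<^sub>C R w ?e"
    by (simp flip: blinfun.diff_right add: scaleC.diff_right[symmetric] LX_apply[OF R_LX[OF w(1)]])
  finally have e: "(z - w) *\<^sub>C R w ?e = ?e" by simp
  have "R z ?e = R w ?e + R z ((z - w) *\<^sub>C R w ?e)"
    using R_resolvent_apply[OF z w(1), of ?e] LX_apply[OF R_LX[OF z]] by simp
  then have "R w ?e = 0" unfolding e by simp
  then have "?e = 0" using e by (metis scaleC.zero_right)
  then show ?thesis by simp
qed

lemma T0_R:
  assumes z: "z \<in> \<Omega>"
  shows "T 0 (R z x) = R z x"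
proof -
  obtain w where w: "w \<in> \<Omega>" "\<omega> < Re w" "R w = laplace w" by (rule obtain_large)
  show ?thesis
    using R_resolvent_apply'[OF z w(1), of x] semigroup_zero_laplace[OF w(2)] by (metis w(3))
qed

lemma has_vector_derivative_R:
  assumes z: "z \<in> \<Omega>" and t: "t \<in> {0..b}"
  shows "((\<lambda>t. T t (R z x)) has_vector_derivative (z *\<^sub>C T t (R z x) + T t x)) (at t within {0..b})"
proof -
  obtain w where w: "w \<in> \<Omega>" "\<omega> < Re w" "R w = laplace w" by (rule obtain_large)
  have eq: "laplace w (x + (z - w) *\<^sub>C R z x) = R z x"
    using R_resolvent_apply'[OF z w(1), of x] by (simp add: w(3))
  show ?thesis
    using has_vector_derivative_laplace[OF w(2) t, of "x + (z - w) *\<^sub>C R z x"] t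
    unfolding eq by (simp add: blinfun.add_right blinfun.diff_right LX_apply[OF in_LX] scaleC.diff_left algebra_simps)
qed

text \<open>A pseudo-resolvent is determined by its value at one point: I + (z - w) laplace z is a
  right inverse of I - (z - w) R w, on whose range \<open>R z\<close> is known. The locale applies
  to \<open>laplace\<close> on its own half-plane, which supplies the identities for this
  inverse.\<close>

lemma R_eq_laplace:
  assumes z: "z \<in> \<Omega>" "\<omega> < Re z"
  shows "R z = laplace z"
proof (rule blinfun_eqI)
  fix y
  obtain w where w: "w \<in> \<Omega>" "\<omega> < Re w" "R w = laplace w" by (rule obtain_large)
  define y' where "y' = y + (z - w) *\<^sub>C laplace z y"
  interpret L: semigroup_resolvent T M \<omega> "{z. \<omega> < Re z}" laplace
    by unfold_locales (rule pseudo_resolvent_laplace extends_laplace_transform_laplace)+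
  have *: "laplace z y = laplace w y'"
    unfolding y'_def using L.R_resolvent_apply'[of z w] z w by simp
  then have y: "y = y' - (z - w) *\<^sub>C R w y'"
    using w(3) by (simp add: y'_def)
  have "R z y = R z y' - (z - w) *\<^sub>C R z (R w y')"
    by (subst y) (simp add: blinfun.diff_right LX_apply[OF R_LX[OF z(1)]])
  also have "\<dots> = R w y'"
    using R_resolvent_apply[OF z(1) w(1), of y'] by simp
  finally show "R z y = laplace z y"
    using * w(3) by simp
qed

text \<open>T t x is the right derivative of the orbit of \<open>R 0 x\<close>, and the difference
  quotients lie in the range of \<open>R 0\<close> because \<open>R 0\<close> commutes with the
  semigroup.\<close>

lemma semigroup_in_closure_range_R0:
  assumes z: "0 \<in> \<Omega>" and t: "0 \<le> t"
  shows "T t x \<in> closure (range (R 0))"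
  unfolding closure_approachable
proof (intro allI impI)
  fix e :: real assume e: "0 < e"
  have "((\<lambda>t. T t (R 0 x)) has_vector_derivative T t x) (at t within {0..t + 1})"
    using has_vector_derivative_R[OF z, of t "t + 1" x] t by simp
  then have "((\<lambda>t. T t (R 0 x)) has_vector_derivative T t x) (at t within {t<..<t + 1})"
    by (rule has_vector_derivative_within_subset) (use t in auto)
  then have "\<forall>\<^sub>F y in at t within {t<..<t + 1}.
      norm (T y (R 0 x) - T t (R 0 x) - (y - t) *\<^sub>R T t x) \<le> e / 2 * norm (y - t)"
    using e unfolding has_vector_derivative_def has_derivative_within_alt2 by (meson half_gt_zero)
  moreover have "\<forall>\<^sub>F y in at t within {t<..<t + 1}. y \<in> {t<..<t + 1}"
    by (simp add: eventually_at_filter)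
  ultimately have "\<forall>\<^sub>F y in at t within {t<..<t + 1}. y \<in> {t<..<t + 1} \<and>
      norm (T y (R 0 x) - T t (R 0 x) - (y - t) *\<^sub>R T t x) \<le> e / 2 * norm (y - t)"
    by eventually_elim simp
  moreover have "at t within {t<..<t + 1} \<noteq> bot"
    by (simp add: trivial_limit_within islimpt_greaterThanLessThan1)
  ultimately obtain y where y: "t < y"
      "norm (T y (R 0 x) - T t (R 0 x) - (y - t) *\<^sub>R T t x) \<le> e / 2 * norm (y - t)"
    using eventually_happens' by fastforce
  have "T y (R 0 x) - T t (R 0 x) - (y - t) *\<^sub>R T t x
      = (y - t) *\<^sub>R (R 0 ((T y x - T t x) /\<^sub>R (y - t)) - T t x)"
    using y t z by (simp add: R_commute blinfun.scaleR_right blinfun.diff_right scaleR_diff_right)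
  then have "norm (R 0 ((T y x - T t x) /\<^sub>R (y - t)) - T t x) \<le> e / 2"
    using y by (simp add: mult.commute)
  then show "\<exists>y\<in>range (R 0). dist y (T t x) < e"
    using e by (intro bexI[of _ "R 0 ((T y x - T t x) /\<^sub>R (y - t))"]) (auto simp: dist_norm)
qed

end

subsection \<open>Lyapunov operators\<close>

text \<open>The imaginary part of \<open>cinner a b\<close> is the real inner product of -i a and b,
  so complex linearity carries real symmetry over to the complex inner product. Operators can thus
  be built from real bilinear forms.\<close>

lemma cinner_selfadjointI:
  assumes A: "A \<in> LX" and sym: "\<And>x y. A x \<bullet> y = (x :: 'a::complex_inner) \<bullet> A y"
  shows "cinner (A x) y = cinner x (A y)"
proof (rule complex_eqI)
  show "Re (cinner (A x) y) = Re (cinner x (A y))"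
    by (simp add: Re_cinner sym)
  have Im: "Im (cinner a b) = (- \<i> *\<^sub>C a) \<bullet> b" for a b :: 'a
    by (simp flip: Re_cinner add: cinner_scaleC_left)
  show "Im (cinner (A x) y) = Im (cinner x (A y))"
    unfolding Im LX_apply[OF A, symmetric] sym ..
qed

lemma cinner_add_swap: "cinner x y + cinner y x = complex_of_real (2 * (x \<bullet> y))"
  by (subst cinner_commute[of y x]) (simp add: complex_eq_iff Re_cinner)

text \<open>Riesz for each fixed x; uniqueness of the representing vector makes it linear in x, and
  testing the form against that vector itself gives the bound.\<close>

lemma bounded_bilinear_representation:
  fixes q :: "'a::{real_inner, complete_space} \<Rightarrow> 'a \<Rightarrow> real"
  assumes q: "bounded_bilinear q"
  shows "\<exists>Q :: 'a \<Rightarrow>\<^sub>L 'a. \<forall>x y. Q x \<bullet> y = q x y"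
proof -
  interpret q: bounded_bilinear q by fact
  have "\<forall>x. \<exists>u. \<forall>y. q x y = u \<bullet> y"
    using Riesz_representation[OF q.bounded_linear_right] by blast
  then obtain f where f: "\<And>x y. f x \<bullet> y = q x y" by metis
  obtain K where K: "\<And>x y. norm (q x y) \<le> norm x * norm y * K" "0 \<le> K"
    using q.nonneg_bounded by blast
  have "bounded_linear f"
  proof (rule bounded_linear_intro[where K = K])
    fix x y :: 'a and r :: real
    show "f (x + y) = f x + f y"
      by (rule vector_eq_ldot[THEN iffD1]) (simp add: inner_commute[of _ "f _"] inner_commute[of _ "f _ + f _"] inner_add_left f q.add_left)
    show "f (r *\<^sub>R x) = r *\<^sub>R f x"
      by (rule vector_eq_ldot[THEN iffD1]) (simp add: inner_commute[of _ "f _"] f q.scaleR_left)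
    have "norm (f x) * norm (f x) \<le> norm x * norm (f x) * K"
      using K(1)[of x "f x"] f[of x "f x"] by (simp add: power2_norm_eq_inner flip: power2_eq_square)
    then show "norm (f x) \<le> norm x * K"
      using K(2) by (cases "norm (f x) = 0") (auto simp: mult.commute mult.left_commute)
  qed
  then show ?thesis
    using f by (intro exI[of _ "Blinfun f"]) (simp add: bounded_linear_Blinfun_apply)
qed

text \<open>The derivative at w is \<open>R w o\<^sub>L R w\<close>. Applying the resolvent identity
  twice leaves the error (z - w)^2 R z R w R w, which boundedness makes quadratically small.\<close>

lemma pseudo_resolvent_vholomorphic:
  assumes R: "pseudo_resolvent \<Omega> R" and S: "S \<subseteq> \<Omega>" and bd: "bounded (R ` S)"
  shows "R vholomorphic_on S"
  unfolding vholomorphic_on_def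
proof (intro ballI exI)
  fix w assume w: "w \<in> S"
  obtain K where K: "\<And>z. z \<in> S \<Longrightarrow> norm (R z) \<le> K"
    using bd by (auto simp: bounded_iff)
  have "0 \<le> K" using K[OF w] norm_ge_zero[of "R w"] by linarith
  have res: "R z - R w = (z - w) *\<^sub>C (R z o\<^sub>L R w)" if "z \<in> S" for z
    using R S w that by (auto simp: pseudo_resolvent_def)
  let ?D = "R w o\<^sub>L R w"
  show "(R has_derivative (\<lambda>h. h *\<^sub>C ?D)) (at w within S)"
  proof (rule has_derivativeI_sandwich[of 1])
    show "bounded_linear (\<lambda>h. h *\<^sub>C ?D)" by (rule scaleC.bounded_linear_left)
    show "((\<lambda>z. K ^ 3 * norm (z - w)) \<longlongrightarrow> 0) (at w within S)"
      by (rule tendsto_eq_intros refl | simp)+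
    fix z assume z: "z \<in> S" "z \<noteq> w" "dist z w < 1"
    have "R z - R w - (z - w) *\<^sub>C ?D = (z - w) *\<^sub>C (R z o\<^sub>L R w) - (z - w) *\<^sub>C ?D"
      by (simp only: res[OF z(1)])
    also have "\<dots> = (z - w) *\<^sub>C ((R z - R w) o\<^sub>L R w)"
      by (simp add: bounded_bilinear.diff_left[OF bounded_bilinear_blinfun_compose] scaleC.diff_right)
    also have "\<dots> = (z - w) *\<^sub>C (z - w) *\<^sub>C ((R z o\<^sub>L R w) o\<^sub>L R w)"
      by (intro blinfun_eqI) (simp add: res[OF z(1)])
    finally have "norm (R z - R w - (z - w) *\<^sub>C ?D) = cmod (z - w) * (cmod (z - w) * norm ((R z o\<^sub>L R w) o\<^sub>L R w))"
      by (simp add: norm_scaleC)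
    also have "norm ((R z o\<^sub>L R w) o\<^sub>L R w) \<le> norm (R z) * norm (R w) * norm (R w)"
      by (meson norm_blinfun_compose mult_right_mono norm_ge_zero order_trans)
    also have "\<dots> \<le> K * K * K"
      using K[OF w] K[OF z(1)] \<open>0 \<le> K\<close> by (intro mult_mono) auto
    finally show "norm (R z - R w - (z - w) *\<^sub>C ?D) / norm (z - w) \<le> K ^ 3 * norm (z - w)"
      using z(2) by (simp add: field_simps power3_eq_cube mult_left_mono)
  qed simp
qed

context operator_semigroup
begin

lemma exponentially_stable_iff_square_integrable:
  "exponentially_stable T \<longleftrightarrow>
    (\<forall>x::'a. (\<integral>\<^sup>+t\<in>{0..}. ennreal ((norm (T t x))\<^sup>2) \<partial>lborel) < \<infinity>)"
proof
  assume "exponentially_stable T"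
  then obtain M \<delta> where M: "M > 0" "\<delta> > 0" "\<And>t. t \<ge> 0 \<Longrightarrow> norm (T t) \<le> M * exp (- \<delta> * t)"
    unfolding exponentially_stable_def by blast
  show "\<forall>x::'a. (\<integral>\<^sup>+t\<in>{0..}. ennreal ((norm (T t x))\<^sup>2) \<partial>lborel) < \<infinity>"
  proof
    fix x :: 'a
    let ?c = "(M * norm x)\<^sup>2"
    let ?F = "\<lambda>t. - ?c / (2 * \<delta>) * exp (- (2 * \<delta>) * t)"
    have le: "(norm (T t x))\<^sup>2 \<le> ?c * exp (- (2 * \<delta>) * t)" if t: "t \<ge> 0" for t
    proof -
      have "norm (T t x) \<le> M * exp (- \<delta> * t) * norm x"
        using norm_blinfun[of "T t" x] M(3)[OF t] by (meson mult_right_mono norm_ge_zero order_trans)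
      then have "(norm (T t x))\<^sup>2 \<le> (M * exp (- \<delta> * t) * norm x)\<^sup>2" by (intro power_mono) auto
      also have "\<dots> = ?c * exp (- (2 * \<delta>) * t)"
        by (simp add: power_mult_distrib exp_double[symmetric] mult.commute mult.left_commute)
      finally show ?thesis .
    qed
    have "(\<integral>\<^sup>+t\<in>{0..}. ennreal ((norm (T t x))\<^sup>2) \<partial>lborel)
        \<le> (\<integral>\<^sup>+t\<in>{0..}. ennreal (?c * exp (- (2 * \<delta>) * t)) \<partial>lborel)"
      by (intro nn_integral_mono) (use le in \<open>auto split: split_indicator intro!: ennreal_leI\<close>)
    also have "\<dots> = ennreal (0 - ?F 0)"
    proof (rule nn_integral_FTC_atLeast)
      show "DERIV ?F t :> ?c * exp (- (2 * \<delta>) * t)" for t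
        using M by (auto intro!: derivative_eq_intros)
      show "(?F \<longlongrightarrow> 0) at_top"
        using tendsto_exp_neg_at_top[of "2 * \<delta>"] M by (intro tendsto_mult_right_zero) auto
    qed auto
    also have "\<dots> < \<infinity>" by simp
    finally show "(\<integral>\<^sup>+t\<in>{0..}. ennreal ((norm (T t x))\<^sup>2) \<partial>lborel) < \<infinity>" .
  qed
next
  assume fin: "\<forall>x::'a. (\<integral>\<^sup>+t\<in>{0..}. ennreal ((norm (T t x))\<^sup>2) \<partial>lborel) < \<infinity>"
  show "exponentially_stable T"
  proof (rule Datko)
    fix x :: 'a
    let ?I = "\<integral>\<^sup>+t\<in>{0..}. ennreal ((norm (T t x))\<^sup>2) \<partial>lborel"
    have "integral {0..\<tau>} (\<lambda>t. (norm (T t x))\<^sup>2) \<le> enn2real ?I" if "0 \<le> \<tau>" for \<tau>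
    proof -
      let ?f = "\<lambda>t. if t \<in> {0..\<tau>} then (norm (T t x))\<^sup>2 else 0"
      let ?J = "integral {0..\<tau>} (\<lambda>t. (norm (T t x))\<^sup>2)"
      have "(\<lambda>t. indicator {0..\<tau>} t *\<^sub>R (norm (T t x))\<^sup>2) \<in> borel_measurable borel"
        by (intro borel_measurable_continuous_on_indicator continuous_intros cont_on) auto
      moreover have "?f = (\<lambda>t. indicator {0..\<tau>} t *\<^sub>R (norm (T t x))\<^sup>2)"
        by (auto simp: fun_eq_iff)
      ultimately have "?f \<in> borel_measurable borel" by simp
      moreover have "(?f has_integral ?J) UNIV"
        unfolding has_integral_restrict_UNIV by (intro integrable_integral square_norm_integrable) auto
      ultimately have "(\<integral>\<^sup>+t. ennreal (?f t) \<partial>lborel) = ennreal ?J"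
        by (intro nn_integral_has_integral_lborel) auto
      moreover have "(\<integral>\<^sup>+t. ennreal (?f t) \<partial>lborel) \<le> ?I"
        by (intro nn_integral_mono) (auto split: split_indicator)
      moreover have "0 \<le> ?J"
        by (intro integral_nonneg square_norm_integrable) auto
      ultimately show ?thesis
        using fin[rule_format, of x] enn2real_mono[of "ennreal ?J" ?I] by simp
    qed
    then show "\<exists>C. \<forall>\<tau>\<ge>0. integral {0..\<tau>} (\<lambda>t. (norm (T t x))\<^sup>2) \<le> C" by blast
  qed
qed

end

context semigroup_resolvent
begin

text \<open>The form V t is differentiable along orbits that start in the range of
  \<open>R 0\<close>. The resulting bound on the square integral is continuous in the starting
  vector, so it extends to the closure, which contains the range of \<open>T 0\<close>.\<close>

lemma exponentially_stable_if_Lyapunov_inequality: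
  assumes z: "0 \<in> \<Omega>" and Q: "positive_operator Q"
    and ineq: "\<And>x. x \<in> closure (range (R 0)) \<Longrightarrow>
      cinner (R 0 x) (Q x) + cinner (Q x) (R 0 x) \<le> - cinner (R 0 x) (R 0 x)"
  shows "exponentially_stable T"
proof -
  have sym: "Q x \<bullet> y = x \<bullet> Q y" for x y
    using Q by (simp flip: Re_cinner add: positive_operator_def)
  have pos: "0 \<le> Q x \<bullet> x" for x
  proof (cases "x = 0")
    case False
    then have "0 < cinner (Q x) x" using Q unfolding positive_operator_def by blast
    then have "0 < Re (cinner (Q x) x)" by (simp add: less_complex_def)
    then show ?thesis unfolding Re_cinner by simp
  qed simp
  have ineq': "2 * (R 0 x \<bullet> Q x) \<le> - (norm (R 0 x))\<^sup>2" if "x \<in> closure (range (R 0))" for x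
    using ineq[OF that] unfolding cinner_add_swap cinner_self by (simp add: less_eq_complex_def)
  have range: "integral {0..\<tau>} (\<lambda>t. (norm (T t (R 0 x)))\<^sup>2) \<le> norm Q * (norm (R 0 x))\<^sup>2"
    if \<tau>: "0 \<le> \<tau>" for x \<tau>
  proof -
    let ?y = "\<lambda>t. T t (R 0 x)"
    define V where "V t = Q (?y t) \<bullet> ?y t" for t
    define V' where "V' t = 2 * (?y t \<bullet> Q (T t x))" for t
    have V: "(V has_vector_derivative V' t) (at t within {0..\<tau>})" if t: "t \<in> {0..\<tau>}" for t
    proof -
      have y: "(?y has_vector_derivative T t x) (at t within {0..\<tau>})"
        using has_vector_derivative_R[OF z t, of x] by simp
      have "((\<lambda>t. Q (?y t) \<bullet> ?y t) has_vector_derivative (Q (?y t) \<bullet> T t x + Q (T t x) \<bullet> ?y t))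
          (at t within {0..\<tau>})"
        by (intro bounded_bilinear.has_vector_derivative[OF bounded_bilinear_inner] y
            bounded_linear.has_vector_derivative[OF blinfun.bounded_linear_right])
      then show ?thesis
        by (simp add: V_def[abs_def] V'_def sym inner_commute)
    qed
    then have int: "(V' has_integral (V \<tau> - V 0)) {0..\<tau>}"
      using \<tau> by (intro fundamental_theorem_of_calculus) auto
    have "integral {0..\<tau>} (\<lambda>t. (norm (?y t))\<^sup>2) \<le> integral {0..\<tau>} (\<lambda>t. - V' t)"
    proof (intro integral_le square_norm_integrable)
      show "(\<lambda>t. - V' t) integrable_on {0..\<tau>}" using int by (auto intro: integrable_neg)
      fix t assume "t \<in> {0..\<tau>}"
      \<comment> \<open>The assumed inequality is used at the vector \<open>T t x\<close>, which
        lies in the closure of the range; there R 0 (T t x) = T t (R 0 x).\<close>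
      then show "(norm (?y t))\<^sup>2 \<le> - V' t"
        using ineq'[OF semigroup_in_closure_range_R0[OF z, of t x]] z
        by (simp add: V'_def R_commute)
    qed simp
    also have "\<dots> = V 0 - V \<tau>"
      using int by (simp add: integral_unique)
    also have "\<dots> \<le> V 0" using pos by (simp add: V_def)
    also have "V 0 \<le> norm (Q (R 0 x)) * norm (R 0 x)"
      using T0_R[OF z, of x] norm_cauchy_schwarz[of "Q (R 0 x)" "R 0 x"] by (simp add: V_def)
    also have "\<dots> \<le> norm Q * norm (R 0 x) * norm (R 0 x)"
      by (intro mult_right_mono norm_blinfun) auto
    finally show ?thesis by (simp add: power2_eq_square mult.assoc)
  qed
  show ?thesis
  proof (rule Datko)
    fix x
    \<comment> \<open>\<open>x\<close> and its projection \<open>v\<close> have the same orbit, and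
      \<open>v\<close> can be approximated from the range of \<open>R 0\<close>.\<close>
    define v where "v = T 0 x"
    have v: "v \<in> closure (range (R 0))"
      unfolding v_def by (rule semigroup_in_closure_range_R0[OF z]) simp
    have Tv: "T t x = T t v" if "0 \<le> t" for t
      using that by (simp add: v_def add_apply)
    have "integral {0..\<tau>} (\<lambda>t. (norm (T t x))\<^sup>2) \<le> 2 * (norm Q * (norm v + 1)\<^sup>2) + 1" if \<tau>: "0 \<le> \<tau>" for \<tau>
    proof -
      obtain K where K: "\<And>t. 0 \<le> t \<Longrightarrow> t \<le> \<tau> \<Longrightarrow> norm (T t) \<le> K"
        using bounded_on_interval[of \<tau>] by (metis atLeastAtMost_iff)
      \<comment> \<open>The approximation error contributes at most 2 K^2 \<tau> d \<le> 1 to the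
        integral. The approximant may depend on \<tau>, since the final bound involves only
        \<open>v\<close> and \<open>Q\<close>.\<close>
      define d where "d = min 1 (1 / (2 * K\<^sup>2 * \<tau> + 1))"
      have d: "0 < d" "d \<le> 1" "d \<le> 1 / (2 * K\<^sup>2 * \<tau> + 1)"
        using \<tau> by (auto simp: d_def add_nonneg_pos)
      obtain y where y: "norm (R 0 y - v) < d"
        using v d(1) unfolding closure_approachable dist_norm by blast
      let ?u = "R 0 y"
      have sq: "(norm (T t x))\<^sup>2 \<le> 2 * (norm (T t ?u))\<^sup>2 + 2 * K\<^sup>2 * d" if t: "t \<in> {0..\<tau>}" for t
      proof -
        have "norm (T t (v - ?u)) \<le> K * norm (v - ?u)"
          using norm_blinfun[of "T t" "v - ?u"] K[of t] t
          by (meson atLeastAtMost_iff mult_right_mono norm_ge_zero order_trans)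
        then have "(norm (T t (v - ?u)))\<^sup>2 \<le> (K * norm (v - ?u))\<^sup>2" by (intro power_mono) auto
        also have "\<dots> \<le> K\<^sup>2 * d"
        proof -
          have "(norm (v - ?u))\<^sup>2 \<le> d\<^sup>2"
            using y by (intro power_mono) (auto simp: norm_minus_commute)
          also have "\<dots> \<le> d" using d by (simp add: power2_eq_square mult_left_le)
          finally show ?thesis by (simp add: power_mult_distrib mult_left_mono)
        qed
        finally have 1: "(norm (T t (v - ?u)))\<^sup>2 \<le> K\<^sup>2 * d" .
        have "T t x = T t ?u + T t (v - ?u)"
          using t by (simp add: Tv blinfun.diff_right)
        then have "norm (T t x) \<le> norm (T t ?u) + norm (T t (v - ?u))"
          by (metis norm_triangle_ineq)
        then have "(norm (T t x))\<^sup>2 \<le> (norm (T t ?u) + norm (T t (v - ?u)))\<^sup>2" by (intro power_mono) auto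
        also have "\<dots> \<le> 2 * (norm (T t ?u))\<^sup>2 + 2 * (norm (T t (v - ?u)))\<^sup>2"
          using sum_squares_bound[of "norm (T t ?u)" "norm (T t (v - ?u))"] by (simp add: power2_sum)
        finally show ?thesis using 1 by simp
      qed
      have "integral {0..\<tau>} (\<lambda>t. (norm (T t x))\<^sup>2) \<le> integral {0..\<tau>} (\<lambda>t. 2 * (norm (T t ?u))\<^sup>2 + 2 * K\<^sup>2 * d)"
        by (intro integral_le integrable_add integrable_on_mult_right square_norm_integrable sq) auto
      also have "\<dots> = 2 * integral {0..\<tau>} (\<lambda>t. (norm (T t ?u))\<^sup>2) + 2 * K\<^sup>2 * \<tau> * d"
        using \<tau> by (subst integral_add) (auto intro!: integrable_on_mult_right square_norm_integrable)
      also have "\<dots> \<le> 2 * (norm Q * (norm ?u)\<^sup>2) + 1"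
      proof (intro add_mono mult_left_mono range \<tau>)
        have "2 * K\<^sup>2 * \<tau> * d \<le> 2 * K\<^sup>2 * \<tau> * (1 / (2 * K\<^sup>2 * \<tau> + 1))"
          using d(3) \<tau> by (intro mult_left_mono) auto
        also have "\<dots> \<le> 1"
          using \<tau> by (simp add: divide_le_eq_1 add_nonneg_pos)
        finally show "2 * K\<^sup>2 * \<tau> * d \<le> 1" .
      qed simp
      also have "(norm ?u)\<^sup>2 \<le> (norm v + 1)\<^sup>2"
        using y d(2) norm_triangle_ineq2[of ?u v] by (intro power_mono) auto
      finally show ?thesis by (simp add: mult_left_mono)
    qed
    then show "\<exists>C. \<forall>\<tau>\<ge>0. integral {0..\<tau>} (\<lambda>t. (norm (T t x))\<^sup>2) \<le> C" by blast
  qed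
qed

section \<open>Consequences of a negative growth bound: the Lyapunov operator and the bounded
  resolvent\<close>

context
  assumes stable: "\<omega> < 0"
begin

text \<open>B is the form of the Gramian, the integral of T(t)* T(t), written without adjoints.
  Exponential decay provides both its convergence and its boundedness.\<close>

lemma energy_form_ex:
  shows "\<exists>B. bounded_bilinear B \<and> (\<forall>x y. ((\<lambda>\<tau>. integral {0..\<tau>} (\<lambda>t. T t x \<bullet> T t y)) \<longlongrightarrow> B x y) at_top)"
proof -
  let ?q = "\<lambda>\<tau> x y. integral {0..\<tau>} (\<lambda>t. T t x \<bullet> T t y)"
  have int: "(\<lambda>t. T t x \<bullet> T t y) integrable_on {a..b}" if "0 \<le> a" for a b x y
    using that by (intro integrable_continuous_interval continuous_intros cont_on) auto
  let ?c = "M\<^sup>2 / (2 * - \<omega>)"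
  have bnd: "norm (integral {a..b} (\<lambda>t. T t x \<bullet> T t y)) \<le> ?c * norm x * norm y * exp (- (2 * - \<omega>) * a)"
    if ab: "0 \<le> a" "a \<le> b" for a b x y
  proof -
    let ?k = "M\<^sup>2 * norm x * norm y"
    note hi = has_integral_mult_right[OF has_integral_exp_neg[of "2 * - \<omega>" a b], of ?k]
    have "norm (T t x \<bullet> T t y) \<le> ?k * exp (- (2 * - \<omega>) * t)" if t: "0 \<le> t" for t
    proof -
      have "norm (T t x \<bullet> T t y) \<le> norm (T t x) * norm (T t y)"
        using Cauchy_Schwarz_ineq2 by simp
      also have "\<dots> \<le> (M * exp (\<omega> * t) * norm x) * (M * exp (\<omega> * t) * norm y)"
        using M_pos by (intro mult_mono norm_apply_le t) auto
      also have "\<dots> = ?k * (exp (\<omega> * t))\<^sup>2"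
        by (simp add: power2_eq_square mult_ac)
      also have "(exp (\<omega> * t))\<^sup>2 = exp (- (2 * - \<omega>) * t)"
        by (simp add: exp_double[symmetric] mult.assoc)
      finally show ?thesis .
    qed
    then have "norm (integral {a..b} (\<lambda>t. T t x \<bullet> T t y)) \<le> integral {a..b} (\<lambda>t. ?k * exp (- (2 * - \<omega>) * t))"
      using ab stable hi by (intro integral_norm_bound_integral int) (auto simp: integrable_on_def)
    also have "\<dots> = ?k * ((exp (- (2 * - \<omega>) * a) - exp (- (2 * - \<omega>) * b)) / (2 * - \<omega>))"
      using hi stable ab by (intro integral_unique) auto
    also have "\<dots> \<le> ?k * (exp (- (2 * - \<omega>) * a) / (2 * - \<omega>))"
      using stable by (intro mult_left_mono divide_right_mono) auto
    finally show ?thesis by (simp add: mult_ac)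
  qed
  have "\<exists>l. ((\<lambda>\<tau>. ?q \<tau> x y) \<longlongrightarrow> l) at_top" for x y
  proof (rule tendsto_at_top_if_increments_tendsto_zero
      [where e = "\<lambda>a. ?c * norm x * norm y * exp (- (2 * - \<omega>) * a)"])
    fix a b :: real assume ab: "0 \<le> a" "a \<le> b"
    have "?q a x y + integral {a..b} (\<lambda>t. T t x \<bullet> T t y) = ?q b x y"
      using ab by (intro Henstock_Kurzweil_Integration.integral_combine int) auto
    then have "?q b x y - ?q a x y = integral {a..b} (\<lambda>t. T t x \<bullet> T t y)"
      by linarith
    then show "norm (?q b x y - ?q a x y) \<le> ?c * norm x * norm y * exp (- (2 * - \<omega>) * a)"
      using bnd[OF ab, of x y] by (simp only:)
  next
    show "((\<lambda>a. ?c * norm x * norm y * exp (- (2 * - \<omega>) * a)) \<longlongrightarrow> 0) at_top"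
      using tendsto_exp_neg_at_top[of "2 * - \<omega>"] stable by (intro tendsto_mult_right_zero) auto
  qed
  then obtain B where B: "\<And>x y. ((\<lambda>\<tau>. ?q \<tau> x y) \<longlongrightarrow> B x y) at_top" by metis
  have uniq: "B x y = l" if "((\<lambda>\<tau>. ?q \<tau> x y) \<longlongrightarrow> l) at_top" for x y l
    using tendsto_unique[OF _ B that] by simp
  have "bounded_bilinear B"
  proof
    fix x x' y y' :: 'a and r :: real
    show "B (x + x') y = B x y + B x' y"
      using tendsto_add[OF B B, of x y x' y]
      by (intro uniq) (simp add: blinfun.add_right inner_add_left integral_add int)
    show "B x (y + y') = B x y + B x y'"
      using tendsto_add[OF B B, of x y x y']
      by (intro uniq) (simp add: blinfun.add_right inner_add_right integral_add int)
    show "B (r *\<^sub>R x) y = r *\<^sub>R B x y"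
      using tendsto_scaleR[OF tendsto_const B, of r x y]
      by (intro uniq) (simp add: blinfun.scaleR_right)
    show "B x (r *\<^sub>R y) = r *\<^sub>R B x y"
      using tendsto_scaleR[OF tendsto_const B, of r x y]
      by (intro uniq) (simp add: blinfun.scaleR_right)
    have "norm (B x y) \<le> norm x * norm y * ?c" for x y
    proof (rule tendsto_upperbound)
      show "((\<lambda>\<tau>. norm (?q \<tau> x y)) \<longlongrightarrow> norm (B x y)) at_top"
        by (intro tendsto_norm B)
      show "\<forall>\<^sub>F \<tau> in at_top. norm (?q \<tau> x y) \<le> norm x * norm y * ?c"
        using eventually_ge_at_top[of 0]
        by eventually_elim (use bnd[OF order_refl, of _ x y] in \<open>simp add: mult_ac\<close>)
    qed simp
    then show "\<exists>K. \<forall>x y. norm (B x y) \<le> norm x * norm y * K" by blast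
  qed
  with B show ?thesis by blast
qed

lemma Lyapunov_equation_if_stable:
  assumes z: "0 \<in> \<Omega>"
  shows "\<exists>Q. positive_operator Q \<and>
    (\<forall>x. cinner (R 0 x) (Q x) + cinner (Q x) (R 0 x) = - cinner (R 0 x) (R 0 x))"
proof -
  let ?q = "\<lambda>\<tau> x y. integral {0..\<tau>} (\<lambda>t. T t x \<bullet> T t y)"
  have int: "(\<lambda>t. T t x \<bullet> T t y) integrable_on {0..b}" for b x y
    by (intro integrable_continuous_interval continuous_intros cont_on) auto
  obtain B where bil: "bounded_bilinear B" and B: "\<And>x y. ((\<lambda>\<tau>. ?q \<tau> x y) \<longlongrightarrow> B x y) at_top"
    using energy_form_ex by blast
  have uniq: "B x y = l" if "((\<lambda>\<tau>. ?q \<tau> x y) \<longlongrightarrow> l) at_top" for x y l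
    using tendsto_unique[OF _ B that] by simp
  have B_sym: "B x y = B y x" for x y
    by (rule uniq) (use B[of y x] in \<open>simp add: inner_commute\<close>)
  \<comment> \<open>Complex linearity of the semigroup in terms of the real form; it makes the
    operator representing the form complex linear.\<close>
  have B_adj: "B (c *\<^sub>C x) y = B x (cnj c *\<^sub>C y)" for c x y
  proof (rule uniq)
    have "?q \<tau> (c *\<^sub>C x) y = ?q \<tau> x (cnj c *\<^sub>C y)" for \<tau>
      by (rule integral_cong) (simp add: LX_apply[OF in_LX] inner_scaleC_left)
    then show "((\<lambda>\<tau>. ?q \<tau> (c *\<^sub>C x) y) \<longlongrightarrow> B x (cnj c *\<^sub>C y)) at_top"
      using B by simp
  qed
  have q_mono: "?q a x x \<le> ?q b x x" if "a \<le> b" for a b x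
    using that by (intro integral_subset_le int) auto
  have q_le_B: "?q \<tau> x x \<le> B x x" for \<tau> x
    by (rule tendsto_lowerbound[OF B])
      (auto simp: eventually_at_top_linorder intro!: exI[of _ \<tau>] q_mono)
  have B_nonneg: "0 \<le> B x x" for x
    using q_le_B[of 0 x] by simp
  \<comment> \<open>If the integral of the continuous function norm (T t x) squared over [0,1]
    vanishes, so does its value at t = 0.\<close>
  have B_pos: "0 < B x x" if "T 0 x \<noteq> 0" for x
  proof (rule ccontr)
    assume "\<not> 0 < B x x"
    then have "?q 1 x x \<le> 0" using q_le_B[of 1 x] by linarith
    moreover have "0 \<le> ?q 1 x x" by (intro integral_nonneg int) auto
    ultimately have "?q 1 x x = 0" by simp
    then have "T 0 x \<bullet> T 0 x = 0"
      by (subst (asm) integral_eq_0_iff) (auto intro!: continuous_intros cont_on)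
    with that show False by simp
  qed
  \<comment> \<open>The derivative of norm (T t (R 0 x)) squared is twice the inner product of
    \<open>T t (R 0 x)\<close> and \<open>T t x\<close>. Integrated over [0, \<infinity>), it leaves
    the value at 0, where \<open>T 0\<close> fixes \<open>R 0 x\<close>.\<close>
  have B_R: "2 * B (R 0 x) x = - (norm (R 0 x))\<^sup>2" for x
  proof -
    have eq: "2 * ?q \<tau> (R 0 x) x = (norm (T \<tau> (R 0 x)))\<^sup>2 - (norm (R 0 x))\<^sup>2" if \<tau>: "0 \<le> \<tau>" for \<tau>
    proof -
      have "((\<lambda>t. 2 * (T t (R 0 x) \<bullet> T t x)) has_integral
          T \<tau> (R 0 x) \<bullet> T \<tau> (R 0 x) - T 0 (R 0 x) \<bullet> T 0 (R 0 x)) {0..\<tau>}"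
      proof (rule fundamental_theorem_of_calculus[OF \<tau>])
        fix t assume t: "t \<in> {0..\<tau>}"
        have "((\<lambda>t. T t (R 0 x)) has_vector_derivative T t x) (at t within {0..\<tau>})"
          using has_vector_derivative_R[OF z t, of x] by simp
        from bounded_bilinear.has_vector_derivative[OF bounded_bilinear_inner this this]
        show "((\<lambda>t. T t (R 0 x) \<bullet> T t (R 0 x)) has_vector_derivative 2 * (T t (R 0 x) \<bullet> T t x))
            (at t within {0..\<tau>})"
          by (simp add: inner_commute)
      qed
      then have "integral {0..\<tau>} (\<lambda>t. 2 * (T t (R 0 x) \<bullet> T t x))
          = T \<tau> (R 0 x) \<bullet> T \<tau> (R 0 x) - T 0 (R 0 x) \<bullet> T 0 (R 0 x)"
        by (rule integral_unique)
      then show ?thesis by (simp add: power2_norm_eq_inner T0_R[OF z])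
    qed
    have "((\<lambda>\<tau>. T \<tau> (R 0 x)) \<longlongrightarrow> 0) at_top"
    proof (rule Lim_null_comparison)
      show "\<forall>\<^sub>F \<tau> in at_top. norm (T \<tau> (R 0 x)) \<le> M * exp (- (- \<omega>) * \<tau>) * norm (R 0 x)"
        using eventually_ge_at_top[of 0] by eventually_elim (use norm_apply_le in simp)
      show "((\<lambda>\<tau>. M * exp (- (- \<omega>) * \<tau>) * norm (R 0 x)) \<longlongrightarrow> 0) at_top"
        using tendsto_exp_neg_at_top[of "- \<omega>"] stable
        by (intro tendsto_mult_left_zero tendsto_mult_right_zero) auto
    qed
    then have "((\<lambda>\<tau>. (norm (T \<tau> (R 0 x)))\<^sup>2 - (norm (R 0 x))\<^sup>2) \<longlongrightarrow> (norm (0::'a))\<^sup>2 - (norm (R 0 x))\<^sup>2) at_top"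
      by (intro tendsto_intros)
    then have "((\<lambda>\<tau>. 2 * ?q \<tau> (R 0 x) x) \<longlongrightarrow> - (norm (R 0 x))\<^sup>2) at_top"
      by (rule Lim_transform_eventually[OF _ eventually_mono[OF eventually_ge_at_top[of 0]], THEN tendsto_eq_rhs])
        (auto simp: eq)
    moreover have "((\<lambda>\<tau>. 2 * ?q \<tau> (R 0 x) x) \<longlongrightarrow> 2 * B (R 0 x) x) at_top"
      by (intro tendsto_intros B)
    ultimately show ?thesis
      using tendsto_unique[OF trivial_limit_at_top_linorder] by blast
  qed
  define N where "N = id_blinfun - T 0"
  have N: "N x = x - T 0 x" for x
    by (simp add: N_def blinfun.diff_left)
  have N_LX: "N (c *\<^sub>C x) = c *\<^sub>C N x" for c x
    by (simp add: N LX_apply[OF in_LX] scaleC.diff_right)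
  have "bounded_bilinear (\<lambda>x y. B x y + N x \<bullet> N y)"
  proof -
    interpret B: bounded_bilinear B by (rule bil)
    interpret N: bounded_bilinear "\<lambda>x y. N x \<bullet> N y"
      by (rule bounded_bilinear.comp[OF bounded_bilinear_inner blinfun.bounded_linear_right blinfun.bounded_linear_right])
    show ?thesis
    proof
      obtain K1 K2 where K: "\<And>x y. norm (B x y) \<le> norm x * norm y * K1"
          "\<And>x y. norm (N x \<bullet> N y) \<le> norm x * norm y * K2"
        using B.bounded N.bounded by blast
      have "norm (B x y + N x \<bullet> N y) \<le> norm x * norm y * (K1 + K2)" for x y
        using norm_triangle_mono[OF K] by (simp add: distrib_left)
      then show "\<exists>K. \<forall>x y. norm (B x y + N x \<bullet> N y) \<le> norm x * norm y * K" by blast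
    qed (simp_all add: B.add_left B.add_right B.scaleR_left B.scaleR_right N.add_left N.add_right
        N.scaleR_left N.scaleR_right distrib_left)
  qed
  then obtain Q :: "'a \<Rightarrow>\<^sub>L 'a" where Q: "\<And>x y. Q x \<bullet> y = B x y + N x \<bullet> N y"
    using bounded_bilinear_representation by blast
  have Q_LX: "Q \<in> LX"
  proof -
    have "Q (c *\<^sub>C x) = c *\<^sub>C Q x" for c x
    proof (rule vector_eq_rdot[THEN iffD1, rule_format])
      fix y
      show "Q (c *\<^sub>C x) \<bullet> y = (c *\<^sub>C Q x) \<bullet> y"
        by (simp add: Q inner_scaleC_left B_adj N_LX)
    qed
    then show ?thesis by (simp add: LX_def)
  qed
  have Q_sym: "Q x \<bullet> y = x \<bullet> Q y" for x y
    using Q[of x y] Q[of y x] by (simp add: B_sym[of x y] inner_commute)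
  have Q_pos: "0 < Q x \<bullet> x" if "x \<noteq> 0" for x
  proof (cases "T 0 x = 0")
    case True
    then have "N x \<bullet> N x > 0" using that by (simp add: N)
    then show ?thesis unfolding Q using B_nonneg[of x] by linarith
  next
    case False
    then show ?thesis using B_pos[of x] by (simp add: Q add_pos_nonneg)
  qed
  have "positive_operator Q"
    unfolding positive_operator_def
  proof (intro conjI allI impI)
    show adj: "cinner (Q x) y = cinner x (Q y)" for x y
      by (rule cinner_selfadjointI[OF Q_LX Q_sym])
    fix x :: 'a assume "x \<noteq> 0"
    moreover have "Im (cinner (Q x) x) = 0"
      using adj[of x x] cinner_commute[of x "Q x"] by (simp add: complex_eq_iff)
    ultimately show "0 < cinner (Q x) x"
      using Q_pos[of x] by (simp add: less_complex_def Re_cinner)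
  qed (rule Q_LX)
  moreover have "cinner (R 0 x) (Q x) + cinner (Q x) (R 0 x) = - cinner (R 0 x) (R 0 x)" for x
  proof -
    have "N (R 0 x) = 0" using T0_R[OF z, of x] by (simp add: N)
    then have "2 * (R 0 x \<bullet> Q x) = - (norm (R 0 x))\<^sup>2"
      using B_R[of x] by (simp add: Q flip: Q_sym)
    then show ?thesis
      unfolding cinner_add_swap cinner_self by (metis of_real_minus)
  qed
  ultimately show ?thesis by blast
qed

text \<open>To the right of \<omega> the resolvent is the Laplace transform, bounded by M / (Re z -
  \<omega>), and \<omega> < 0 makes this uniform for Re z > 0. The assumption \<open>max\<close>
  carries the maximality of \<open>\<Omega>\<close>.\<close>

lemma in_H_infinity_if_stable:
  assumes max: "{z. \<omega> < Re z} \<subseteq> \<Omega>"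
  shows "in_H_infinity \<Omega> R"
proof -
  have sub: "{z. 0 < Re z} \<subseteq> \<Omega>" using max stable by fastforce
  have "norm (R z) \<le> M / - \<omega>" if "0 < Re z" for z
  proof -
    have "norm (R z) \<le> M / (Re z - \<omega>)"
    proof -
      have "\<omega> < Re z" using that stable by linarith
      moreover from this have "z \<in> \<Omega>" using max by blast
      ultimately show ?thesis using norm_laplace R_eq_laplace by simp
    qed
    also have "\<dots> \<le> M / - \<omega>"
      using that stable M_pos by (intro frac_le) auto
    finally show ?thesis .
  qed
  then have "bounded (R ` {z. 0 < Re z})"
    by (auto simp: bounded_iff)
  then show ?thesis
    using sub pseudo pseudo_resolvent_vholomorphic by (auto simp: in_H_infinity_def)
qed

end

end

subsection \<open>Plancherel's identity\<close>

text \<open>The crude factor 2 comes from bounding real and imaginary parts separately; only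
  boundedness matters for the uses made of it.\<close>

lemma norm_cinner_le: "norm (cinner x y) \<le> norm x * norm y * 2"
proof -
  have Im: "Im (cinner x y) = (- \<i> *\<^sub>C x) \<bullet> y"
    by (simp flip: Re_cinner add: cinner_scaleC_left)
  have "norm (- \<i> *\<^sub>C x) = norm x"
    by (simp add: norm_scaleC)
  then have "\<bar>Im (cinner x y)\<bar> \<le> norm x * norm y"
    unfolding Im using Cauchy_Schwarz_ineq2[of "- \<i> *\<^sub>C x" y] by simp
  moreover have "\<bar>Re (cinner x y)\<bar> \<le> norm x * norm y"
    unfolding Re_cinner by (rule Cauchy_Schwarz_ineq2)
  ultimately show ?thesis
    using cmod_le[of "cinner x y"] by linarith
qed

interpretation cinner: bounded_bilinear "cinner :: 'a::complex_inner \<Rightarrow> 'a \<Rightarrow> complex"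
proof
  fix x x' y y' :: 'a and r :: real
  show "cinner (x + x') y = cinner x y + cinner x' y"
    by (rule cinner_add_left)
  show "cinner x (y + y') = cinner x y + cinner x y'"
    by (metis cinner_add_left cinner_commute complex_cnj_add)
  show "cinner (r *\<^sub>R x) y = r *\<^sub>R cinner x y"
    by (simp flip: scaleC_of_real add: cinner_scaleC_left scaleR_conv_of_real scaleC_complex_def)
  show "cinner x (r *\<^sub>R y) = r *\<^sub>R cinner x y"
    by (simp flip: scaleC_of_real add: cinner_scaleC_right scaleR_conv_of_real scaleC_complex_def)
  show "\<exists>K. \<forall>x y :: 'a. norm (cinner x y) \<le> norm x * norm y * K"
    using norm_cinner_le by blast
qed

lemma integrable_exp_neg:
  assumes "\<kappa> > 0"
  shows "integrable lborel (\<lambda>t. indicator {0..} t * exp (- \<kappa> * t) :: real)"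
    and "(\<integral>t. indicator {0..} t * exp (- \<kappa> * t) \<partial>lborel) = 1 / \<kappa>"
proof -
  have *: "(\<integral>\<^sup>+t. ennreal (indicator {0..} t * exp (- \<kappa> * t)) \<partial>lborel) = ennreal (1 / \<kappa>)"
  proof -
    have "(\<integral>\<^sup>+t. ennreal (exp (- \<kappa> * t)) * indicator {0..} t \<partial>lborel)
        = ennreal (0 - (- 1 / \<kappa> * exp (- \<kappa> * 0)))"
    proof (rule nn_integral_FTC_atLeast)
      show "DERIV (\<lambda>t. - 1 / \<kappa> * exp (- \<kappa> * t)) t :> exp (- \<kappa> * t)" for t
        using assms by (auto intro!: derivative_eq_intros)
      show "((\<lambda>t. - 1 / \<kappa> * exp (- \<kappa> * t)) \<longlongrightarrow> 0) at_top"
        using tendsto_exp_neg_at_top[OF assms] by (intro tendsto_mult_right_zero)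
    qed auto
    moreover have "(\<integral>\<^sup>+t. ennreal (indicator {0..} t * exp (- \<kappa> * t)) \<partial>lborel)
        = (\<integral>\<^sup>+t. ennreal (exp (- \<kappa> * t)) * indicator {0..} t \<partial>lborel)"
      by (intro nn_integral_cong) (auto split: split_indicator)
    ultimately show ?thesis by simp
  qed
  show int: "integrable lborel (\<lambda>t. indicator {0..} t * exp (- \<kappa> * t) :: real)"
    by (rule integrableI_nonneg) (use * in auto)
  show "(\<integral>t. indicator {0..} t * exp (- \<kappa> * t) \<partial>lborel) = 1 / \<kappa>"
    using * nn_integral_eq_integral[OF int] assms by simp
qed

text \<open>\<open>G\<close> is the one-sided Fourier transform of \<open>g\<close> as an improper
  gauge integral, the form in which the resolvent on a vertical line arises. The exponential
  envelope supplies all dominating functions.\<close>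

locale fourier_pair =
  fixes g G :: "real \<Rightarrow> 'a::chilbert_space" and C \<kappa> :: real
  assumes \<kappa>_pos: "0 < \<kappa>"
    and g_cont: "continuous_on {0..} g"
    and decay: "0 \<le> t \<Longrightarrow> norm (g t) \<le> C * exp (- \<kappa> * t)"
    and transform: "((\<lambda>\<tau>. integral {0..\<tau>} (\<lambda>t. iexp (- (s * t)) *\<^sub>C g t)) \<longlongrightarrow> G s) at_top"
begin

text \<open>The squared norm of \<open>G s\<close> is the Fourier integral of this scalar function
  of (t, u) at the frequency (s, -s).\<close>

definition kernel :: "real \<times> real \<Rightarrow> complex"
  where "kernel p = indicator ({0..} \<times> {0..}) p *\<^sub>R cinner (g (fst p)) (g (snd p))"

definition envelope :: "real \<Rightarrow> real"
  where "envelope t = indicator {0..} t * exp (- \<kappa> * t)"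

lemma C_nonneg: "0 \<le> C"
  using order_trans[OF norm_ge_zero decay[of 0]] by simp

lemma envelope_nonneg: "0 \<le> envelope t"
  by (simp add: envelope_def)

lemma envelope_le: "envelope t \<le> 1"
  using \<kappa>_pos by (auto simp: envelope_def split: split_indicator)

lemma integrable_envelope: "integrable lborel envelope"
  unfolding envelope_def[abs_def] by (rule integrable_exp_neg(1)[OF \<kappa>_pos])

lemma kernel_measurable: "kernel \<in> borel_measurable borel"
proof -
  have "continuous_on ({0..} \<times> {0..}) (\<lambda>p. cinner (g (fst p)) (g (snd p)))"
    by (intro cinner.continuous_on continuous_on_compose2[OF g_cont] continuous_intros) auto
  then show ?thesis
    unfolding kernel_def[abs_def]
    by (intro borel_measurable_continuous_on_indicator) (auto intro!: borel_closed closed_Times)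
qed

lemma kernel_measurable_pair [measurable]: "kernel \<in> borel_measurable (borel \<Otimes>\<^sub>M borel)"
  using kernel_measurable by (simp add: borel_prod)

lemma norm_kernel: "norm (kernel (t, u)) \<le> 2 * C\<^sup>2 * (envelope t * envelope u)"
proof (cases "0 \<le> t \<and> 0 \<le> u")
  case True
  have "norm (cinner (g t) (g u)) \<le> norm (g t) * norm (g u) * 2"
    by (rule norm_cinner_le)
  also have "\<dots> \<le> (C * exp (- \<kappa> * t)) * (C * exp (- \<kappa> * u)) * 2"
    using True C_nonneg by (intro mult_mono mult_right_mono decay mult_nonneg_nonneg) auto
  finally show ?thesis
    using True by (simp add: kernel_def envelope_def power2_eq_square mult_ac)
qed (auto simp: kernel_def envelope_def)

lemma integrable_kernel_row: "integrable lborel (\<lambda>u. kernel (t, u))"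
  by (rule Bochner_Integration.integrable_bound[of _ "\<lambda>u. 2 * C\<^sup>2 * (envelope t * envelope u)"])
    (use integrable_envelope norm_kernel envelope_nonneg in \<open>auto\<close>)

lemma integrable_kernel: "integrable lborel kernel"
proof -
  have "integrable (lborel \<Otimes>\<^sub>M lborel) kernel"
  proof (rule lborel_pair.Fubini_integrable)
    show "kernel \<in> borel_measurable (lborel \<Otimes>\<^sub>M lborel)"
      using kernel_measurable by (simp add: lborel_prod)
    show "AE t in lborel. integrable lborel (\<lambda>u. kernel (t, u))"
      by (simp add: integrable_kernel_row)
    show "integrable lborel (\<lambda>t. \<integral>u. norm (kernel (t, u)) \<partial>lborel)"
    proof (rule Bochner_Integration.integrable_bound[of _ "\<lambda>t. 2 * C\<^sup>2 * envelope t * (\<integral>u. envelope u \<partial>lborel)"])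
      show "integrable lborel (\<lambda>t. 2 * C\<^sup>2 * envelope t * (\<integral>u. envelope u \<partial>lborel))"
        using integrable_envelope by auto
      show "(\<lambda>t. \<integral>u. norm (kernel (t, u)) \<partial>lborel) \<in> borel_measurable lborel"
        by measurable
      show "AE t in lborel. norm (\<integral>u. norm (kernel (t, u)) \<partial>lborel) \<le> norm (2 * C\<^sup>2 * envelope t * (\<integral>u. envelope u \<partial>lborel))"
      proof (intro AE_I2)
        fix t
        have "(\<integral>u. norm (kernel (t, u)) \<partial>lborel) \<le> (\<integral>u. 2 * C\<^sup>2 * envelope t * envelope u \<partial>lborel)"
          using integrable_envelope integrable_kernel_row norm_kernel by (intro integral_mono) (auto simp: mult.assoc)
        then show "norm (\<integral>u. norm (kernel (t, u)) \<partial>lborel) \<le> norm (2 * C\<^sup>2 * envelope t * (\<integral>u. envelope u \<partial>lborel))"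
          by (simp add: abs_of_nonneg integral_nonneg_AE)
      qed
    qed
  qed
  then show ?thesis by (simp add: lborel_prod)
qed

text \<open>Pairing with a fixed vector turns the improper gauge integral into a Lebesgue integral
  of a scalar function.\<close>

lemma cinner_transform:
  "cinner (G s) y = (\<integral>t. iexp (- (s * t)) * (indicator {0..} t *\<^sub>R cinner (g t) y) \<partial>lborel)"
proof -
  let ?h = "\<lambda>t. iexp (- (s * t)) * cinner (g t) y"
  have h_cont: "continuous_on {0..} ?h"
    by (intro continuous_intros cinner.continuous_on g_cont)
  have int: "set_integrable lborel {0..} ?h"
    unfolding set_integrable_def
  proof (rule Bochner_Integration.integrable_bound[of _ "\<lambda>t. (2 * C * norm y) * envelope t"])
    show "integrable lborel (\<lambda>t. (2 * C * norm y) * envelope t)"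
      using integrable_envelope by auto
    show "(\<lambda>t. indicat_real {0..} t *\<^sub>R ?h t) \<in> borel_measurable lborel"
      using borel_measurable_continuous_on_indicator[OF _ h_cont] by simp
    have "norm (?h t) \<le> 2 * C * norm y * exp (- \<kappa> * t)" if "0 \<le> t" for t
    proof -
      have "norm (?h t) = norm (cinner (g t) y)" by (simp add: norm_mult)
      also have "\<dots> \<le> norm (g t) * norm y * 2" by (rule norm_cinner_le)
      also have "\<dots> \<le> C * exp (- \<kappa> * t) * norm y * 2"
        using that by (intro mult_right_mono decay) auto
      finally show ?thesis by (simp add: mult_ac)
    qed
    then show "AE t in lborel. norm (indicat_real {0..} t *\<^sub>R ?h t) \<le> norm ((2 * C * norm y) * envelope t)"
      using C_nonneg by (intro AE_I2) (auto simp: envelope_def abs_mult split: split_indicator)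
  qed
  have "set_lebesgue_integral lborel {0..\<tau>} ?h = cinner (integral {0..\<tau>} (\<lambda>t. iexp (- (s * t)) *\<^sub>C g t)) y" for \<tau>
  proof -
    have "set_lebesgue_integral lborel {0..\<tau>} ?h = integral {0..\<tau>} ?h"
      by (intro set_borel_integral_eq_integral set_integrable_subset[OF int]) auto
    also have "\<dots> = integral {0..\<tau>} ((\<lambda>v. cinner v y) \<circ> (\<lambda>t. iexp (- (s * t)) *\<^sub>C g t))"
      by (simp add: o_def cinner_scaleC_left)
    also have "\<dots> = cinner (integral {0..\<tau>} (\<lambda>t. iexp (- (s * t)) *\<^sub>C g t)) y"
      by (intro integral_linear cinner.bounded_linear_left integrable_continuous_interval
          scaleC.continuous_on continuous_intros continuous_on_subset[OF g_cont]) auto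
    finally show ?thesis .
  qed
  moreover have "((\<lambda>\<tau>. cinner (integral {0..\<tau>} (\<lambda>t. iexp (- (s * t)) *\<^sub>C g t)) y) \<longlongrightarrow> cinner (G s) y) at_top"
    by (intro cinner.tendsto transform tendsto_const)
  moreover have "((\<lambda>\<tau>. set_lebesgue_integral lborel {0..\<tau>} ?h) \<longlongrightarrow> set_lebesgue_integral lborel {0..} ?h) at_top"
    by (rule tendsto_set_lebesgue_integral_at_top[OF _ int]) auto
  ultimately have "cinner (G s) y = set_lebesgue_integral lborel {0..} ?h"
    using tendsto_unique[OF trivial_limit_at_top_linorder] by simp
  then show ?thesis
    by (simp add: set_lebesgue_integral_def)
qed

lemma integrable_phase_kernel: "integrable lborel (\<lambda>p. iexp (- (s * (fst p - snd p))) * kernel p)"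
proof (rule Bochner_Integration.integrable_bound[OF integrable_kernel])
  have "(\<lambda>p. iexp (- (s * (fst p - snd p)))) \<in> borel_measurable borel"
    by (intro borel_measurable_continuous_onI continuous_intros)
  then show "(\<lambda>p. iexp (- (s * (fst p - snd p))) * kernel p) \<in> borel_measurable lborel"
    using kernel_measurable by simp
qed (simp add: norm_mult)

text \<open>The transform is expanded twice: once with \<open>y = G s\<close>, and then, after
  conjugation, with \<open>y = g t\<close>. Fubini joins the two integrals.\<close>

lemma norm_transform:
  "complex_of_real ((norm (G s))\<^sup>2) = (\<integral>p. iexp (- (s * (fst p - snd p))) * kernel p \<partial>lborel)"
proof -
  have inner: "indicator {0..} t *\<^sub>R cinner (g t) (G s) = (\<integral>u. iexp (s * u) * kernel (t, u) \<partial>lborel)" for t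
  proof -
    have "cinner (g t) (G s) = cnj (cinner (G s) (g t))"
      by (rule cinner_commute)
    also have "\<dots> = (\<integral>u. cnj (iexp (- (s * u)) * (indicator {0..} u *\<^sub>R cinner (g u) (g t))) \<partial>lborel)"
      unfolding cinner_transform by (rule Bochner_Integration.integral_cnj[symmetric])
    also have "\<dots> = (\<integral>u. iexp (s * u) * (indicator {0..} u *\<^sub>R cinner (g t) (g u)) \<partial>lborel)"
      by (intro Bochner_Integration.integral_cong refl)
        (simp add: exp_cnj cinner_commute[of "g t"] scaleR_conv_of_real)
    finally have *: "cinner (g t) (G s) = (\<integral>u. iexp (s * u) * (indicator {0..} u *\<^sub>R cinner (g t) (g u)) \<partial>lborel)" .
    show ?thesis
      by (cases "0 \<le> t") (auto simp: * kernel_def indicator_times)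
  qed
  have "complex_of_real ((norm (G s))\<^sup>2) = (\<integral>t. iexp (- (s * t)) * (indicator {0..} t *\<^sub>R cinner (g t) (G s)) \<partial>lborel)"
    unfolding cinner_self[symmetric] by (rule cinner_transform)
  also have "\<dots> = (\<integral>t. (\<integral>u. iexp (- (s * (t - u))) * kernel (t, u) \<partial>lborel) \<partial>lborel)"
    unfolding inner
  proof (intro Bochner_Integration.integral_cong refl)
    fix t
    have "iexp (- (s * (t - u))) * kernel (t, u) = iexp (- (s * t)) * (iexp (s * u) * kernel (t, u))" for u
      by (simp add: algebra_simps flip: exp_add)
    note * = this
    show "iexp (- (s * t)) * (\<integral>u. iexp (s * u) * kernel (t, u) \<partial>lborel)
        = (\<integral>u. iexp (- (s * (t - u))) * kernel (t, u) \<partial>lborel)"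
      by (simp only: * integral_mult_right_zero)
  qed
  also have "\<dots> = (\<integral>p. iexp (- (s * (fst p - snd p))) * kernel p \<partial>lborel)"
    using lborel_pair.integral_fst'[of "\<lambda>p. iexp (- (s * (fst p - snd p))) * kernel p"] integrable_phase_kernel
    by (simp add: lborel_prod)
  finally show ?thesis .
qed

text \<open>Fubini again; the inner integral over \<sigma> is the characteristic function of the
  standard normal law at -n (t - u). Integrability of the average is a by-product, with no prior
  regularity of \<open>G\<close>.\<close>

lemma gaussian_average_transform:
  fixes n :: real
  shows "integrable std_normal_distribution (\<lambda>\<sigma>. (norm (G (n * \<sigma>)))\<^sup>2)"
    and "complex_of_real (\<integral>\<sigma>. (norm (G (n * \<sigma>)))\<^sup>2 \<partial>std_normal_distribution)
      = (\<integral>p. complex_of_real (exp (- (n * (fst p - snd p))\<^sup>2 / 2)) * kernel p \<partial>lborel)"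
proof -
  let ?N = std_normal_distribution
  let ?F = "\<lambda>(\<sigma>, p). iexp (- (n * \<sigma> * (fst p - snd p))) * kernel p"
  interpret N: real_distribution ?N by (rule real_dist_normal_dist)
  interpret P: pair_sigma_finite ?N "lborel :: (real \<times> real) measure" ..
  have F_meas: "?F \<in> borel_measurable (?N \<Otimes>\<^sub>M lborel)"
  proof -
    have "(\<lambda>q :: real \<times> real \<times> real. iexp (- (n * fst q * (fst (snd q) - snd (snd q))))) \<in> borel_measurable borel"
      by (intro borel_measurable_continuous_onI continuous_intros)
    moreover have "(\<lambda>q :: real \<times> real \<times> real. kernel (snd q)) \<in> borel_measurable borel"
      by (rule measurable_compose[OF _ kernel_measurable]) (intro borel_measurable_continuous_onI continuous_intros)
    ultimately have "?F \<in> borel_measurable borel"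
      by (simp add: case_prod_unfold)
    also have "borel_measurable borel = borel_measurable (?N \<Otimes>\<^sub>M (lborel :: (real \<times> real) measure))"
      by (intro measurable_cong_sets refl) (simp add: borel_prod[symmetric] cong: sets_pair_measure_cong)
    finally show ?thesis .
  qed
  have F_int: "integrable (?N \<Otimes>\<^sub>M lborel) ?F"
  proof (rule P.Fubini_integrable[OF F_meas])
    show "integrable ?N (\<lambda>\<sigma>. \<integral>p. norm (?F (\<sigma>, p)) \<partial>lborel)"
      by (simp add: norm_mult)
    show "AE \<sigma> in ?N. integrable lborel (\<lambda>p. ?F (\<sigma>, p))"
      unfolding case_prod_conv by (intro AE_I2 integrable_phase_kernel)
  qed
  have eq: "(\<integral>p. ?F (\<sigma>, p) \<partial>lborel) = complex_of_real ((norm (G (n * \<sigma>)))\<^sup>2)" for \<sigma>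
    using norm_transform[of "n * \<sigma>"] by simp
  have "integrable ?N (\<lambda>\<sigma>. complex_of_real ((norm (G (n * \<sigma>)))\<^sup>2))"
    using P.integrable_fst'[OF F_int] unfolding eq .
  then show "integrable ?N (\<lambda>\<sigma>. (norm (G (n * \<sigma>)))\<^sup>2)"
    by (simp only: complex_of_real_integrable_eq)
  have "complex_of_real (\<integral>\<sigma>. (norm (G (n * \<sigma>)))\<^sup>2 \<partial>?N) = (\<integral>\<sigma>. (\<integral>p. ?F (\<sigma>, p) \<partial>lborel) \<partial>?N)"
    unfolding eq by (simp only: integral_complex_of_real)
  also have "\<dots> = (\<integral>p. (\<integral>\<sigma>. ?F (\<sigma>, p) \<partial>?N) \<partial>lborel)"
    using P.Fubini_integral[of "\<lambda>\<sigma> p. ?F (\<sigma>, p)"] F_int by (simp add: case_prod_unfold)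
  also have "\<dots> = (\<integral>p. complex_of_real (exp (- (n * (fst p - snd p))\<^sup>2 / 2)) * kernel p \<partial>lborel)"
  proof (intro Bochner_Integration.integral_cong refl)
    fix p
    have "(\<integral>\<sigma>. ?F (\<sigma>, p) \<partial>?N) = char ?N (- (n * (fst p - snd p))) * kernel p"
      unfolding char_def by (simp add: mult_ac)
    then show "(\<integral>\<sigma>. ?F (\<sigma>, p) \<partial>?N) = complex_of_real (exp (- (n * (fst p - snd p))\<^sup>2 / 2)) * kernel p"
      by (simp only: char_std_normal_distribution power2_minus)
  qed
  finally show "complex_of_real (\<integral>\<sigma>. (norm (G (n * \<sigma>)))\<^sup>2 \<partial>?N)
      = (\<integral>p. complex_of_real (exp (- (n * (fst p - snd p))\<^sup>2 / 2)) * kernel p \<partial>lborel)" .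
qed

definition energy :: real
  where "energy = (\<integral>t. indicator {0..} t * (norm (g t))\<^sup>2 \<partial>lborel)"

text \<open>With s = n \<sigma> the weight on the transform is exp (-s^2 / (2 n^2)) / (2 \<pi>), so
  this is Plancherel's identity in the limit of wide Gaussians. On the kernel side the weight
  concentrates on the diagonal t = u, and the factor n / sqrt (2 \<pi>) makes it a probability
  density in u.\<close>

lemma Plancherel_gaussian:
  "(\<lambda>n. real n / sqrt (2 * pi) * (\<integral>\<sigma>. (norm (G (real n * \<sigma>)))\<^sup>2 \<partial>std_normal_distribution)) \<longlonglongrightarrow> energy"
proof -
  let ?\<phi> = std_normal_density
  \<comment> \<open>The substitution u = t + v / n: the density no longer depends on n, and
    dominated convergence applies in v and then in t.\<close>
  let ?h = "\<lambda>n t v. complex_of_real (?\<phi> v) * kernel (t, t + v / real n)"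
  have eq: "complex_of_real (real n / sqrt (2 * pi) * (\<integral>\<sigma>. (norm (G (real n * \<sigma>)))\<^sup>2 \<partial>std_normal_distribution))
      = (\<integral>t. (\<integral>v. ?h n t v \<partial>lborel) \<partial>lborel)" if n: "0 < n" for n :: nat
  proof -
    let ?f = "\<lambda>p. complex_of_real (real n * ?\<phi> (real n * (snd p - fst p))) * kernel p"
    have "integrable lborel ?f"
    proof (rule Bochner_Integration.integrable_bound[OF integrable_mult_right[OF integrable_kernel, of "real n"]])
      have "(\<lambda>p :: real \<times> real. complex_of_real (real n * ?\<phi> (real n * (snd p - fst p)))) \<in> borel_measurable borel"
        unfolding std_normal_density_def by (intro borel_measurable_continuous_onI continuous_intros) auto
      then show "?f \<in> borel_measurable lborel"
        using kernel_measurable by simp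
      have "?\<phi> x \<le> 1" for x
      proof -
        have "?\<phi> x \<le> 1 / sqrt (2 * pi) * 1"
          unfolding std_normal_density_def by (intro mult_left_mono) auto
        also have "\<dots> \<le> 1"
          using pi_gt3 by simp
        finally show ?thesis .
      qed
      then show "AE p in lborel. norm (?f p) \<le> norm (real n * kernel p)"
        by (intro AE_I2) (auto simp: norm_mult mult_left_le intro!: mult_right_mono)
    qed
    then have "integrable (lborel \<Otimes>\<^sub>M lborel) ?f" by (simp add: lborel_prod)
    from lborel_pair.integral_fst'[OF this]
    have *: "(\<integral>p. ?f p \<partial>lborel) = (\<integral>t. (\<integral>u. ?f (t, u) \<partial>lborel) \<partial>lborel)"
      by (simp add: lborel_prod)
    have "complex_of_real (real n / sqrt (2 * pi) * (\<integral>\<sigma>. (norm (G (real n * \<sigma>)))\<^sup>2 \<partial>std_normal_distribution))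
        = complex_of_real (real n / sqrt (2 * pi))
          * (\<integral>p. complex_of_real (exp (- (real n * (fst p - snd p))\<^sup>2 / 2)) * kernel p \<partial>lborel)"
      by (simp only: of_real_mult gaussian_average_transform(2))
    also have "\<dots> = (\<integral>p. ?f p \<partial>lborel)"
      unfolding integral_mult_right_zero[symmetric]
      by (intro Bochner_Integration.integral_cong refl)
        (simp add: std_normal_density_def power_mult_distrib power2_commute)
    also have "\<dots> = (\<integral>t. (\<integral>v. ?h n t v \<partial>lborel) \<partial>lborel)"
      unfolding *
    proof (rule Bochner_Integration.integral_cong[OF refl])
      fix t
      have "(\<integral>u. ?f (t, u) \<partial>lborel) = \<bar>1 / real n\<bar> *\<^sub>R (\<integral>v. ?f (t, t + 1 / real n * v) \<partial>lborel)"
        using n by (intro lborel_integral_real_affine) auto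
      also have "\<dots> = (\<integral>v. ?h n t v \<partial>lborel)"
        unfolding integral_scaleR_right[symmetric] using n
        by (intro Bochner_Integration.integral_cong refl) (simp add: scaleR_conv_of_real)
      finally show "(\<integral>u. ?f (t, u) \<partial>lborel) = (\<integral>v. ?h n t v \<partial>lborel)" .
    qed
    finally show ?thesis .
  qed
  have \<phi>_int: "integrable lborel ?\<phi>" "(\<integral>v. ?\<phi> v \<partial>lborel) = 1"
    by (auto intro!: integrable_normal_density integral_normal_density)
  have h_bound: "norm (?h n t v) \<le> 2 * C\<^sup>2 * envelope t * ?\<phi> v" for n t v
  proof -
    have "norm (kernel (t, t + v / real n)) \<le> 2 * C\<^sup>2 * (envelope t * envelope (t + v / real n))"
      by (rule norm_kernel)
    also have "\<dots> \<le> 2 * C\<^sup>2 * (envelope t * 1)"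
      by (intro mult_left_mono envelope_le envelope_nonneg) auto
    finally show ?thesis
      by (simp add: norm_mult mult.commute mult_left_mono)
  qed
  have h_meas: "(\<lambda>(t, v). ?h n t v) \<in> borel_measurable (borel \<Otimes>\<^sub>M borel)" for n :: nat
    unfolding case_prod_unfold by measurable
  have h_row: "(\<lambda>v. ?h n t v) \<in> borel_measurable lborel" for n t
    using h_meas by measurable
  have "(\<lambda>n. \<integral>t. (\<integral>v. ?h n t v \<partial>lborel) \<partial>lborel) \<longlonglongrightarrow> (\<integral>t. kernel (t, t) \<partial>lborel)"
  proof (rule integral_dominated_convergence[where w = "\<lambda>t. 2 * C\<^sup>2 * envelope t"])
    show "(\<lambda>t. kernel (t, t)) \<in> borel_measurable lborel" by measurable
    show "(\<lambda>t. \<integral>v. ?h n t v \<partial>lborel) \<in> borel_measurable lborel" for n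
      using h_meas[of n] by measurable
    show "integrable lborel (\<lambda>t. 2 * C\<^sup>2 * envelope t)" using integrable_envelope by auto
    show "AE t in lborel. norm (\<integral>v. ?h n t v \<partial>lborel) \<le> 2 * C\<^sup>2 * envelope t" for n
    proof (intro AE_I2)
      fix t
      have "norm (\<integral>v. ?h n t v \<partial>lborel) \<le> (\<integral>v. 2 * C\<^sup>2 * envelope t * ?\<phi> v \<partial>lborel)"
      proof (intro Bochner_Integration.integral_norm_bound_integral h_bound)
        show int: "integrable lborel (\<lambda>v. 2 * C\<^sup>2 * envelope t * ?\<phi> v)"
          by (intro integrable_mult_right \<phi>_int)
        show "integrable lborel (?h n t)"
          by (rule Bochner_Integration.integrable_bound[OF int h_row])
            (intro AE_I2 order_trans[OF h_bound], simp)
      qed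
      then show "norm (\<integral>v. ?h n t v \<partial>lborel) \<le> 2 * C\<^sup>2 * envelope t"
        by (simp add: \<phi>_int)
    qed
    \<comment> \<open>At t = 0 the cutoff of the kernel makes the limit fail in general for v < 0,
      so this null set is discarded.\<close>
    show "AE t in lborel. (\<lambda>n. \<integral>v. ?h n t v \<partial>lborel) \<longlonglongrightarrow> kernel (t, t)"
      using AE_lborel_singleton[of 0]
    proof eventually_elim
      case (elim t)
      have lim: "(\<lambda>n. kernel (t, t + v / real n)) \<longlonglongrightarrow> kernel (t, t)" for v
      proof (cases "t < 0")
        case True
        then show ?thesis by (simp add: kernel_def)
      next
        case False
        with elim have t: "0 < t" by simp
        have u: "(\<lambda>n. t + v / real n) \<longlonglongrightarrow> t"
          by real_asymp
        have "isCont g t"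
          using g_cont t by (intro continuous_on_interior[of "{0..}"]) (auto simp: interior_Ici)
        then have g: "(\<lambda>n. g (t + v / real n)) \<longlonglongrightarrow> g t"
          by (rule isCont_tendsto_compose[OF _ u])
        have "(\<lambda>n. cinner (g t) (g (t + v / real n))) \<longlonglongrightarrow> cinner (g t) (g t)"
          by (intro cinner.tendsto tendsto_const g)
        then have "(\<lambda>n. cinner (g t) (g (t + v / real n))) \<longlonglongrightarrow> kernel (t, t)"
          using t by (simp add: kernel_def)
        moreover have "\<forall>\<^sub>F n in sequentially. 0 < t + v / real n"
          using order_tendstoD(1)[OF u t] .
        then have "\<forall>\<^sub>F n in sequentially. cinner (g t) (g (t + v / real n)) = kernel (t, t + v / real n)"
          by eventually_elim (use t in \<open>simp add: kernel_def\<close>)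
        ultimately show ?thesis by (rule Lim_transform_eventually)
      qed
      have "(\<lambda>n. \<integral>v. ?h n t v \<partial>lborel) \<longlonglongrightarrow> (\<integral>v. complex_of_real (?\<phi> v) * kernel (t, t) \<partial>lborel)"
      proof (rule integral_dominated_convergence[where w = "\<lambda>v. 2 * C\<^sup>2 * envelope t * ?\<phi> v"])
        show "integrable lborel (\<lambda>v. 2 * C\<^sup>2 * envelope t * ?\<phi> v)"
          by (intro integrable_mult_right \<phi>_int)
        show "AE v in lborel. (\<lambda>n. ?h n t v) \<longlonglongrightarrow> complex_of_real (?\<phi> v) * kernel (t, t)"
          by (intro AE_I2 tendsto_intros lim)
        show "(\<lambda>v. complex_of_real (?\<phi> v) * kernel (t, t)) \<in> borel_measurable lborel" by measurable
      qed (use h_row h_bound in auto)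
      also have "(\<integral>v. complex_of_real (?\<phi> v) * kernel (t, t) \<partial>lborel) = kernel (t, t)"
        using \<phi>_int by (simp add: integral_complex_of_real)
      finally show ?case .
    qed
  qed
  also have "(\<integral>t. kernel (t, t) \<partial>lborel) = complex_of_real energy"
    unfolding energy_def integral_complex_of_real[symmetric]
    by (intro Bochner_Integration.integral_cong refl) (auto simp: kernel_def cinner_self split: split_indicator)
  finally have "(\<lambda>n. complex_of_real (real n / sqrt (2 * pi)
      * (\<integral>\<sigma>. (norm (G (real n * \<sigma>)))\<^sup>2 \<partial>std_normal_distribution))) \<longlonglongrightarrow> complex_of_real energy"
    by (rule Lim_transform_eventually) (use eq in \<open>auto simp: eventually_sequentially intro!: exI[of _ 1]\<close>)
  then show ?thesis by (simp only: tendsto_of_real_iff)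
qed

lemma energy_integrable: "integrable lborel (\<lambda>t. indicator {0..} t * (norm (g t))\<^sup>2)"
  and energy_le: "energy \<le> C\<^sup>2 / (2 * \<kappa>)"
proof -
  have le: "indicator {0..} t * (norm (g t))\<^sup>2 \<le> C\<^sup>2 * (indicator {0..} t * exp (- (2 * \<kappa>) * t))" for t
  proof (cases "0 \<le> t")
    case True
    have "(norm (g t))\<^sup>2 \<le> (C * exp (- \<kappa> * t))\<^sup>2"
      using decay[OF True] by (intro power_mono) auto
    also have "\<dots> = C\<^sup>2 * exp (- (2 * \<kappa>) * t)"
      by (simp add: power_mult_distrib mult.assoc flip: exp_double)
    finally show ?thesis using True by simp
  qed auto
  have \<kappa>2: "0 < 2 * \<kappa>" using \<kappa>_pos by simp
  have int: "integrable lborel (\<lambda>t. C\<^sup>2 * (indicator {0..} t * exp (- (2 * \<kappa>) * t)))"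
    by (intro integrable_mult_right integrable_exp_neg \<kappa>2)
  show *: "integrable lborel (\<lambda>t. indicator {0..} t * (norm (g t))\<^sup>2)"
  proof (rule Bochner_Integration.integrable_bound[OF int])
    have "(\<lambda>t. indicator {0..} t *\<^sub>R (norm (g t))\<^sup>2) \<in> borel_measurable borel"
      by (intro borel_measurable_continuous_on_indicator continuous_intros g_cont) auto
    then show "(\<lambda>t. indicator {0..} t * (norm (g t))\<^sup>2) \<in> borel_measurable lborel" by simp
    show "AE t in lborel. norm (indicator {0..} t * (norm (g t))\<^sup>2)
        \<le> norm (C\<^sup>2 * (indicator {0..} t * exp (- (2 * \<kappa>) * t)))"
      using le by (intro AE_I2) (auto simp: abs_mult)
  qed
  have "energy \<le> (\<integral>t. C\<^sup>2 * (indicator {0..} t * exp (- (2 * \<kappa>) * t)) \<partial>lborel)"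
    unfolding energy_def by (intro integral_mono * int le)
  also have "\<dots> = C\<^sup>2 / (2 * \<kappa>)"
    unfolding integral_mult_right_zero integrable_exp_neg(2)[OF \<kappa>2] by simp
  finally show "energy \<le> C\<^sup>2 / (2 * \<kappa>)" .
qed

lemma integral_le_energy: "integral {0..\<tau>} (\<lambda>t. (norm (g t))\<^sup>2) \<le> energy"
proof -
  have "set_integrable lborel {0..} (\<lambda>t. (norm (g t))\<^sup>2)"
    using energy_integrable by (simp add: set_integrable_def)
  then have int: "set_integrable lborel {0..\<tau>} (\<lambda>t. (norm (g t))\<^sup>2)"
    by (rule set_integrable_subset) auto
  have "integral {0..\<tau>} (\<lambda>t. (norm (g t))\<^sup>2) = (LINT t:{0..\<tau>}|lborel. (norm (g t))\<^sup>2)"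
    using set_borel_integral_eq_integral(2)[OF int] by simp
  also have "\<dots> \<le> energy"
    unfolding energy_def set_lebesgue_integral_def
    using int energy_integrable
    by (intro integral_mono) (auto simp: set_integrable_def split: split_indicator)
  finally show ?thesis .
qed

end

text \<open>Both averages use the same Gaussian weights, so a pointwise comparison of the transforms
  survives averaging and the limit. The decay constants of the two pairs do not enter the
  estimate.\<close>

lemma energy_mono_transform:
  assumes f: "fourier_pair f F C \<kappa>" and g: "fourier_pair g G C' \<kappa>'"
    and le: "\<And>s. norm (F s) \<le> K * norm (G s)"
  shows "fourier_pair.energy f \<le> K\<^sup>2 * fourier_pair.energy g"
proof -
  interpret f: fourier_pair f F C \<kappa> by (rule f)
  interpret g: fourier_pair g G C' \<kappa>' by (rule g)
  let ?N = std_normal_distribution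
  have "real n / sqrt (2 * pi) * (\<integral>\<sigma>. (norm (F (real n * \<sigma>)))\<^sup>2 \<partial>?N)
      \<le> K\<^sup>2 * (real n / sqrt (2 * pi) * (\<integral>\<sigma>. (norm (G (real n * \<sigma>)))\<^sup>2 \<partial>?N))" for n
  proof -
    have "(norm (F s))\<^sup>2 \<le> K\<^sup>2 * (norm (G s))\<^sup>2" for s
      using power_mono[OF le[of s], of 2] by (simp add: power_mult_distrib)
    then have "(\<integral>\<sigma>. (norm (F (real n * \<sigma>)))\<^sup>2 \<partial>?N) \<le> (\<integral>\<sigma>. K\<^sup>2 * (norm (G (real n * \<sigma>)))\<^sup>2 \<partial>?N)"
      by (intro integral_mono integrable_mult_right f.gaussian_average_transform(1) g.gaussian_average_transform(1))
    also have "\<dots> = K\<^sup>2 * (\<integral>\<sigma>. (norm (G (real n * \<sigma>)))\<^sup>2 \<partial>?N)"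
      by (rule integral_mult_right_zero)
    finally have "(\<integral>\<sigma>. (norm (F (real n * \<sigma>)))\<^sup>2 \<partial>?N) \<le> K\<^sup>2 * (\<integral>\<sigma>. (norm (G (real n * \<sigma>)))\<^sup>2 \<partial>?N)" .
    from mult_left_mono[OF this, of "real n / sqrt (2 * pi)"] show ?thesis
      by (simp add: mult_ac)
  qed
  then show ?thesis
    by (intro LIMSEQ_le[OF f.Plancherel_gaussian tendsto_mult[OF tendsto_const g.Plancherel_gaussian]]) auto
qed

subsection \<open>Bounded resolvents\<close>

lemma (in operator_semigroup) rescaled: "operator_semigroup (\<lambda>t. exp (- \<eta> * t) *\<^sub>R T t)"
proof
  show "exp (- \<eta> * t) *\<^sub>R T t \<in> LX" if "0 \<le> t" for t
    by (simp add: LX_def blinfun.scaleR_left LX_apply[OF in_LX[OF that]] scaleC.scaleR_right)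
  show "exp (- \<eta> * (s + t)) *\<^sub>R T (s + t) = exp (- \<eta> * s) *\<^sub>R T s o\<^sub>L exp (- \<eta> * t) *\<^sub>R T t"
    if "0 \<le> s" "0 \<le> t" for s t
  proof -
    have "exp (- \<eta> * (s + t)) = exp (- \<eta> * s) * exp (- \<eta> * t)"
      by (simp add: algebra_simps flip: exp_add)
    then show ?thesis
      using that by (intro blinfun_eqI)
        (simp only: add blinfun.scaleR_left blinfun.scaleR_right blinfun_apply_blinfun_compose scaleR_scaleR mult.commute)
  qed
  show "continuous_on {0..} (\<lambda>t. (exp (- \<eta> * t) *\<^sub>R T t) x)" for x
    by (simp add: blinfun.scaleR_left) (intro continuous_intros cont)
qed

context semigroup_resolvent
begin

text \<open>On the line Re z = \<eta> the factor exp (-\<eta> t) acts as damping and the rest of exp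
  (-z t) as the phase; the minus before \<open>R\<close> undoes the sign convention.\<close>

lemma fourier_pair_semigroup:
  assumes \<eta>: "\<omega> < \<eta>" and \<Omega>: "\<And>s. Complex \<eta> s \<in> \<Omega>"
  shows "fourier_pair (\<lambda>t. exp (- \<eta> * t) *\<^sub>R T t x) (\<lambda>s. - R (Complex \<eta> s) x) (M * norm x) (\<eta> - \<omega>)"
proof
  show "0 < \<eta> - \<omega>" using \<eta> by simp
  show "continuous_on {0..} (\<lambda>t. exp (- \<eta> * t) *\<^sub>R T t x)"
    by (intro continuous_intros cont)
  have eq: "damped (Complex \<eta> s) x t = iexp (- (s * t)) *\<^sub>C (exp (- \<eta> * t) *\<^sub>R T t x)" for s t
  proof -
    have "exp (- Complex \<eta> s * of_real t) = iexp (- (s * t)) * complex_of_real (exp (- \<eta> * t))"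
      by (simp add: Complex_eq algebra_simps flip: exp_of_real exp_add)
    then show ?thesis
      by (simp only: damped_def scaleC_scaleC flip: scaleC_of_real)
  qed
  show "norm (exp (- \<eta> * t) *\<^sub>R T t x) \<le> M * norm x * exp (- (\<eta> - \<omega>) * t)" if "0 \<le> t" for t
    using norm_damped[OF that, of "Complex \<eta> 0" x] unfolding eq by (simp add: norm_scaleC)
  show "((\<lambda>\<tau>. integral {0..\<tau>} (\<lambda>t. iexp (- (s * t)) *\<^sub>C (exp (- \<eta> * t) *\<^sub>R T t x))) \<longlongrightarrow> - R (Complex \<eta> s) x) at_top" for s
    unfolding eq[symmetric]
    using tendsto_minus[OF laplace_lim[of "Complex \<eta> s" x]] \<eta> R_eq_laplace[OF \<Omega>, of s] by simp
qed

end

context operator_semigroup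
begin

lemma exponentially_stable_if_bounded_resolvent:
  assumes pseudo: "pseudo_resolvent \<Omega> R" and ext: "extends_laplace_transform T \<Omega> R"
    and sub: "{z. 0 < Re z} \<subseteq> \<Omega>" and bd: "bounded (R ` {z. 0 < Re z})"
  shows "exponentially_stable T"
proof -
  define P where "P \<epsilon> \<longleftrightarrow> (\<exists>M>0. \<forall>t\<ge>0. norm (T t) \<le> M * exp (\<epsilon> * t))" for \<epsilon>
  have resolvent: "semigroup_resolvent T M \<epsilon> \<Omega> R" if "0 < M" "\<And>t. 0 \<le> t \<Longrightarrow> norm (T t) \<le> M * exp (\<epsilon> * t)" for M \<epsilon>
    by unfold_locales (use that pseudo ext in auto)
  obtain K where K: "\<And>z. 0 < Re z \<Longrightarrow> norm (R z) \<le> K"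
    using bd by (auto simp: bounded_iff)
  have K0: "0 \<le> K" using K[of 1] norm_ge_zero[of "R 1"] by (simp del: norm_ge_zero)
  obtain M0 \<omega>0 where M0: "0 < M0" "0 < \<omega>0" "\<And>t. 0 \<le> t \<Longrightarrow> norm (T t) \<le> M0 * exp (\<omega>0 * t)"
    using exponential_bound by blast
  \<comment> \<open>Abscissa of the reference line; at distance 1 from the first growth bound the
    energy there is at most half of \<open>(M0 * norm x)\<^sup>2\<close>.\<close>
  define \<omega>1 where "\<omega>1 = \<omega>0 + 1"
  obtain K1 where K1: "\<And>t. 0 \<le> t \<Longrightarrow> t \<le> 1 \<Longrightarrow> norm (T t) \<le> K1"
    using bounded_on_interval[of 1] by (metis atLeastAtMost_iff)
  \<comment> \<open>The first factor comes from comparing the resolvent on two vertical lines, the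
    second from the energy on the reference line.\<close>
  define D where "D = (1 + \<omega>1 * K)\<^sup>2 * (M0\<^sup>2 / 2)"
  have D0: "0 \<le> D" by (simp add: D_def)
  \<comment> \<open>The threshold of \<open>Datko_quantitative\<close>, increased by 1 to be
    positive. It is fixed before \<epsilon> and \<eta> are chosen.\<close>
  define t0 where "t0 = 4 * (K1\<^sup>2 * (D + 1) * D) + 1"
  have t0: "0 < t0" using D0 by (simp add: t0_def add_nonneg_pos)
  \<comment> \<open>\<epsilon> < \<eta> puts the line inside the region of convergence, \<eta> > 0
    makes the bounds \<open>K\<close> and \<open>K1\<close> available, and \<eta> \<le> \<omega>1
    keeps the distance to the reference line below \<omega>1.\<close>
  have contraction: "norm (T t0) \<le> 1 / 2 * exp (\<eta> * t0)"
    if P: "P \<epsilon>" and \<eta>: "\<epsilon> < \<eta>" "0 < \<eta>" "\<eta> \<le> \<omega>1" for \<epsilon> \<eta>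
  proof -
    let ?S = "\<lambda>t. exp (- \<eta> * t) *\<^sub>R T t"
    obtain M where M: "0 < M" "\<And>t. 0 \<le> t \<Longrightarrow> norm (T t) \<le> M * exp (\<epsilon> * t)"
      using P unfolding P_def by blast
    have in_\<Omega>: "Complex a s \<in> \<Omega>" if "0 < a" for a s
      using sub that by auto
    have energy: "integral {0..\<tau>} (\<lambda>t. (norm (?S t x))\<^sup>2) \<le> D * (norm x)\<^sup>2" for x \<tau>
    proof -
      have f: "fourier_pair (\<lambda>t. exp (- \<eta> * t) *\<^sub>R T t x) (\<lambda>s. - R (Complex \<eta> s) x) (M * norm x) (\<eta> - \<epsilon>)"
        by (rule semigroup_resolvent.fourier_pair_semigroup[OF resolvent[OF M]])
          (use \<eta> in_\<Omega> in auto)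
      have g: "fourier_pair (\<lambda>t. exp (- \<omega>1 * t) *\<^sub>R T t x) (\<lambda>s. - R (Complex \<omega>1 s) x) (M0 * norm x) (\<omega>1 - \<omega>0)"
        by (rule semigroup_resolvent.fourier_pair_semigroup[OF resolvent[OF M0(1,3)]])
          (use M0 in_\<Omega> in \<open>auto simp: \<omega>1_def\<close>)
      have le: "norm (- R (Complex \<eta> s) x) \<le> (1 + \<omega>1 * K) * norm (- R (Complex \<omega>1 s) x)" for s
      proof -
        let ?z = "Complex \<eta> s" and ?w = "Complex \<omega>1 s"
        have "R ?z x = R ?w x + (?z - ?w) *\<^sub>C R ?z (R ?w x)"
          by (rule semigroup_resolvent.R_resolvent_apply[OF resolvent[OF M0(1,3)]])
            (use \<eta> in_\<Omega> in auto)
        then have "norm (R ?z x) \<le> norm (R ?w x) + norm ((?z - ?w) *\<^sub>C R ?z (R ?w x))"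
          by (metis norm_triangle_ineq)
        also have "norm ((?z - ?w) *\<^sub>C R ?z (R ?w x)) \<le> \<omega>1 * (K * norm (R ?w x))"
          unfolding norm_scaleC
        proof (rule mult_mono)
          show "cmod (?z - ?w) \<le> \<omega>1" using \<eta> by (simp add: cmod_def)
          show "norm (R ?z (R ?w x)) \<le> K * norm (R ?w x)"
            using \<eta> by (intro order_trans[OF norm_blinfun] mult_right_mono K) auto
        qed (use \<eta> in auto)
        finally show ?thesis by (simp add: algebra_simps)
      qed
      have "integral {0..\<tau>} (\<lambda>t. (norm (?S t x))\<^sup>2) \<le> fourier_pair.energy (\<lambda>t. exp (- \<eta> * t) *\<^sub>R T t x)"
        using fourier_pair.integral_le_energy[OF f] by (simp add: blinfun.scaleR_left)
      also have "\<dots> \<le> (1 + \<omega>1 * K)\<^sup>2 * fourier_pair.energy (\<lambda>t. exp (- \<omega>1 * t) *\<^sub>R T t x)"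
        by (rule energy_mono_transform[OF f g le])
      also have "\<dots> \<le> (1 + \<omega>1 * K)\<^sup>2 * ((M0 * norm x)\<^sup>2 / 2)"
        using fourier_pair.energy_le[OF g] by (intro mult_left_mono) (auto simp: \<omega>1_def)
      also have "\<dots> = D * (norm x)\<^sup>2" by (simp add: D_def power_mult_distrib)
      finally show ?thesis .
    qed
    have S1: "norm (?S t) \<le> K1" if t: "0 \<le> t" "t \<le> 1" for t
    proof -
      have "norm (?S t) \<le> 1 * norm (T t)"
        unfolding norm_scaleR using t \<eta> by (intro mult_right_mono) auto
      then show ?thesis using K1[OF t] by simp
    qed
    have "norm (?S t0) \<le> 1 / 2"
      using t0 by (intro operator_semigroup.Datko_quantitative[OF rescaled S1 D0 energy]) (auto simp: t0_def)
    then show ?thesis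
      by (simp add: exp_minus field_simps)
  qed
  \<comment> \<open>Halving the norm at time \<open>t0\<close> lowers the rate by ln 2 / t0.\<close>
  define d where "d = ln 2 / t0"
  have d: "0 < d" using t0 by (simp add: d_def)
  have step: "P (\<epsilon> - d / 2)" if P: "P \<epsilon>" and \<epsilon>: "0 \<le> \<epsilon>" "\<epsilon> \<le> \<omega>0" for \<epsilon>
  proof -
    \<comment> \<open>At most half of \<open>d\<close> is spent on moving to the right of
      \<epsilon>, so at least the other half remains as gain. Since \<epsilon> \<le> \<omega>0 <
      \<omega>1, the minimum still exceeds \<epsilon>.\<close>
    define \<eta> where "\<eta> = min \<omega>1 (\<epsilon> + d / 2)"
    have \<eta>: "\<epsilon> < \<eta>" "0 < \<eta>" "\<eta> \<le> \<omega>1"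
      using \<epsilon> d by (auto simp: \<eta>_def \<omega>1_def)
    obtain M where M: "0 < M"
        "\<And>t. 0 \<le> t \<Longrightarrow> norm (T t) \<le> M * exp (ln (1 / 2 * exp (\<eta> * t0)) / t0 * t)"
      using growth[OF t0 _ contraction[OF P \<eta>]] by auto
    have rate: "ln (1 / 2 * exp (\<eta> * t0)) / t0 \<le> \<epsilon> - d / 2"
    proof -
      have "ln (1 / 2 * exp (\<eta> * t0)) / t0 = \<eta> - d"
        using t0 by (simp add: ln_mult ln_div d_def field_simps)
      also have "\<dots> \<le> \<epsilon> - d / 2" by (simp add: \<eta>_def)
      finally show ?thesis .
    qed
    have "norm (T t) \<le> M * exp ((\<epsilon> - d / 2) * t)" if t: "0 \<le> t" for t
    proof -
      have "M * exp (ln (1 / 2 * exp (\<eta> * t0)) / t0 * t) \<le> M * exp ((\<epsilon> - d / 2) * t)"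
        using M(1) mult_right_mono[OF rate t] by simp
      then show ?thesis using M(2)[OF t] by linarith
    qed
    then show ?thesis using M(1) unfolding P_def by blast
  qed
  \<comment> \<open>Without a negative rate every iterate would be nonnegative, so the step could be
    repeated for ever, although each one lowers the rate by \<open>d / 2\<close>.\<close>
  have "\<exists>\<epsilon><0. P \<epsilon>"
  proof (rule ccontr)
    assume no: "\<not> (\<exists>\<epsilon><0. P \<epsilon>)"
    have all: "P (\<omega>0 - real n * (d / 2))" for n
    proof (induction n)
      case 0
      then show ?case using M0 unfolding P_def by auto
    next
      case (Suc n)
      then have "0 \<le> \<omega>0 - real n * (d / 2)" using no by force
      then have "P (\<omega>0 - real n * (d / 2) - d / 2)"
        using Suc d by (intro step) auto
      then show ?case by (simp add: algebra_simps add_divide_distrib)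
    qed
    obtain n where "\<omega>0 < real n * (d / 2)"
      using reals_Archimedean3[of "d / 2"] d by auto
    with all[of n] no show False by auto
  qed
  then obtain \<epsilon> M where "\<epsilon> < 0" "0 < M" "\<And>t. 0 \<le> t \<Longrightarrow> norm (T t) \<le> M * exp (\<epsilon> * t)"
    unfolding P_def by blast
  then show ?thesis
    unfolding exponentially_stable_def by (intro exI[of _ M] conjI exI[of _ "- \<epsilon>"]) auto
qed

end

theorem proposition3p1:
  fixes T :: "real \<Rightarrow> 'a::chilbert_space \<Rightarrow>\<^sub>L 'a"
    and R :: "complex \<Rightarrow> 'a \<Rightarrow>\<^sub>L 'a"
    and \<Omega> :: "complex set"
  assumes "degenerate_semigroup T"
    and "associated_pseudo_resolvent T \<Omega> R"
    and "0 \<in> \<Omega>"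
  shows
    "(exponentially_stable T \<longleftrightarrow>
        (\<exists>Q::'a \<Rightarrow>\<^sub>L 'a. positive_operator Q \<and>
          (\<forall>x \<in> closure (range (R 0)).
            cinner (R 0 x) (Q x) + cinner (Q x) (R 0 x) = - cinner (R 0 x) (R 0 x)))) \<and>
     (exponentially_stable T \<longleftrightarrow>
        (\<exists>Q::'a \<Rightarrow>\<^sub>L 'a. positive_operator Q \<and>
          (\<forall>x \<in> closure (range (R 0)).
            cinner (R 0 x) (Q x) + cinner (Q x) (R 0 x) \<le> - cinner (R 0 x) (R 0 x)))) \<and>
     (exponentially_stable T \<longleftrightarrow>
        (\<forall>x. (\<integral>\<^sup>+t\<in>{0..}. ennreal ((norm (T t x))\<^sup>2) \<partial>lborel) < \<infinity>)) \<and>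
     (exponentially_stable T \<longleftrightarrow> in_H_infinity \<Omega> R)"
    (is "(?a \<longleftrightarrow> ?b) \<and> (?a \<longleftrightarrow> ?c) \<and> (?a \<longleftrightarrow> ?d) \<and> (?a \<longleftrightarrow> ?e)")
proof -
  interpret operator_semigroup T
    by (rule degenerate_semigroup_imp_operator_semigroup[OF assms(1)])
  have pseudo: "pseudo_resolvent \<Omega> R" and ext: "extends_laplace_transform T \<Omega> R"
    and max: "\<And>\<Omega>' R'. pseudo_resolvent \<Omega>' R' \<Longrightarrow> extends_laplace_transform T \<Omega>' R' \<Longrightarrow> \<Omega>' \<subseteq> \<Omega>"
    using assms(2) by (auto simp: associated_pseudo_resolvent_def)
  have resolvent: "semigroup_resolvent T M \<omega> \<Omega> R"
    if "0 < M" "\<And>t. 0 \<le> t \<Longrightarrow> norm (T t) \<le> M * exp (\<omega> * t)" for M \<omega>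
    by unfold_locales (use that pseudo ext in auto)
  have ab: ?b and ae: ?e if a: ?a
  proof -
    obtain M \<delta> where M: "0 < M" "0 < \<delta>" "\<And>t. 0 \<le> t \<Longrightarrow> norm (T t) \<le> M * exp (- \<delta> * t)"
      using a unfolding exponentially_stable_def by blast
    interpret semigroup_resolvent T M "- \<delta>" \<Omega> R
      by (rule resolvent) (use M in auto)
    \<comment> \<open>Maximality of \<open>\<Omega>\<close>, compared with the Laplace transform on
      its half-plane of convergence.\<close>
    have "{z. - \<delta> < Re z} \<subseteq> \<Omega>"
      by (rule max[OF pseudo_resolvent_laplace extends_laplace_transform_laplace])
    then show ?e using M by (intro in_H_infinity_if_stable) auto
    show ?b using M Lyapunov_equation_if_stable[OF _ assms(3)] by fastforce
  qed
  have bc: ?c if ?b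
    using that by force
  have ca: ?a if ?c
  proof -
    obtain M \<omega> where M: "0 < M" "\<And>t. 0 \<le> t \<Longrightarrow> norm (T t) \<le> M * exp (\<omega> * t)"
      using exponential_bound by blast
    interpret semigroup_resolvent T M \<omega> \<Omega> R
      by (rule resolvent[OF M])
    show ?a
      using that exponentially_stable_if_Lyapunov_inequality[OF assms(3)] by blast
  qed
  have ea: ?a if ?e
    using that exponentially_stable_if_bounded_resolvent[OF pseudo ext] by (auto simp: in_H_infinity_def)
  show ?thesis
    using ab ae bc ca ea exponentially_stable_iff_square_integrable by blast
qed

end
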